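(* Let $\mathbb{F}$ be a field with $\operatorname{char}(\mathbb{F})\neq 2$. Then $\overline{\mathbf{VP}_e}=\{(f_n) \mid \underline{L}_{\mathrm{Fib}}(f_n)\text{ is bounded by a polynomial in } n\}$.
   Context: The generalized Fibonacci polynomial $F_m(x_1,\ldots,x_m)$ is defined by $F_0=1$, $F_1=x_1$, $F_m=x_mF_{m-1}+F_{m-2}$ for $m\geq 2$. Let $\varepsilon$ be a formal variable. A parametrized affine linear form is an affine linear form in $x_1,x_2,\ldots$ with coefficients in $\mathbb{F}(\varepsilon)$. For $f\in\mathbb{F}[x_1,x_2,\ldots]$, the border Fibonacci complexity $\underline{L}_{\mathrm{Fib}}(f)$ is the smallest $m$ such that there exist parametrized affine linear forms $\ell_1(\varepsilon),\ldots,\ell_m(\varepsilon)$ with $F_m(\ell_1(\varepsilon),\ldots,\ell_m(\varepsilon))\in f+\varepsilon\,\mathbb{F}[\varepsilon,x_1,x_2,\ldots]$. $\mathbf{VP}_e(\mathbb{K})$ is the class of families of polynomials over the field $\mathbb{K}$ (in polynomially many variables) with polynomially bounded formula size (fan-in 2 formulas with $+,\times$, leaves variables or constants of $\mathbb{K}$). The approximation closure $\overline{\mathbf{VP}_e}$ (over $\mathbb{F}$) consists of families $(f_n)$ over $\mathbb{F}$ for which there are polynomials $f_{n;i}\in\mathbb{F}[x_1,x_2,\ldots]$ and a function $e:\mathbb{N}\to\mathbb{N}$ such that $g_n=f_n+\varepsilon f_{n;1}+\cdots+\varepsilon^{e(n)}f_{n;e(n)}$ defines a family in $\mathbf{VP}_e(\mathbb{F}(\varepsilon))$.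 *)

theory Defs
  imports
    "HOL-Library.Poly_Mapping"
    "HOL-Library.Extended_Nat"
    "HOL-Computational_Algebra.Computational_Algebra"
begin

section \<open>Multivariate polynomials\<close>

text \<open>
  Polynomials in countably many indeterminates, indexed by \<^typ>\<open>nat\<close>: a monomial is a finitely
  supported exponent vector, a polynomial a finitely supported map from monomials to coefficients.
  The ring structure is the convolution product of \<^theory>\<open>HOL-Library.Poly_Mapping\<close>.
\<close>

type_synonym 'a mpoly = "(nat \<Rightarrow>\<^sub>0 nat) \<Rightarrow>\<^sub>0 'a"

definition mvar :: "nat \<Rightarrow> 'a::zero_neq_one mpoly" where
  "mvar i = Poly_Mapping.single (Poly_Mapping.single i 1) 1"

definition mconst :: "'a::zero \<Rightarrow> 'a mpoly" where
  "mconst c = Poly_Mapping.single 0 c"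

definition mvars :: "'a::zero mpoly \<Rightarrow> nat set" where
  "mvars p = (\<Union>t\<in>Poly_Mapping.keys p. Poly_Mapping.keys t)"

section \<open>Polynomially bounded families\<close>

definition poly_bounded :: "(nat \<Rightarrow> enat) \<Rightarrow> bool" where
  "poly_bounded s \<longleftrightarrow> (\<exists>q :: nat poly. \<forall>n. s n \<le> enat (poly q n))"

text \<open>
  A family is a sequence of polynomials in polynomially many variables. This is part of the notion
  of a family: for instance a linear form in exponentially many variables has border Fibonacci
  complexity at most 1, but it has no formula of polynomial size.
\<close>

definition families :: "(nat \<Rightarrow> 'a::zero mpoly) set" where
  "families = {f. poly_bounded (\<lambda>n. enat (card (mvars (f n))))}"

section \<open>Formulas\<close>

datatype 'k formula =
    Var nat
  | Const 'k
  | Add "'k formula" "'k formula"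
  | Mult "'k formula" "'k formula"

primrec formula_poly :: "'k::comm_ring_1 formula \<Rightarrow> 'k mpoly" where
  "formula_poly (Var i) = mvar i"
| "formula_poly (Const c) = mconst c"
| "formula_poly (Add a b) = formula_poly a + formula_poly b"
| "formula_poly (Mult a b) = formula_poly a * formula_poly b"

text \<open>
  The number of vertices, leaves included (unlike the generated \<^const>\<open>size\<close> function,
  which gives leaves size 0).
\<close>

primrec formula_size :: "'k formula \<Rightarrow> nat" where
  "formula_size (Var i) = 1"
| "formula_size (Const c) = 1"
| "formula_size (Add a b) = 1 + formula_size a + formula_size b"
| "formula_size (Mult a b) = 1 + formula_size a + formula_size b"

definition formula_complexity :: "'k::comm_ring_1 mpoly \<Rightarrow> enat" where
  "formula_complexity p = (INF \<phi>\<in>{\<phi>. formula_poly \<phi> = p}. enat (formula_size \<phi>))"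

definition VPe :: "(nat \<Rightarrow> 'k::field mpoly) set" where
  "VPe = {f \<in> families. poly_bounded (\<lambda>n. formula_complexity (f n))}"

section \<open>Approximation\<close>

text \<open>
  The field of rational functions in \<open>\<epsilon>\<close> over \<^typ>\<open>'a\<close> is \<^typ>\<open>'a poly fract\<close>, the
  indeterminate of \<^typ>\<open>'a poly\<close> being \<open>\<epsilon>\<close>.
\<close>

definition eps :: "'a::field poly fract" where
  "eps = to_fract [:0, 1:]"

text \<open>
  The inclusions into the polynomial ring over the rational functions in \<open>\<epsilon>\<close>: the first one is
  that of the polynomials not involving \<open>\<epsilon>\<close>, the second one that of the polynomials in \<open>\<epsilon>\<close> and the
  other indeterminates, which are represented as polynomials with coefficients in \<^typ>\<open>'a poly\<close>.
\<close>

definition embed :: "'a::field mpoly \<Rightarrow> 'a poly fract mpoly" where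
  "embed = Poly_Mapping.map (\<lambda>c. to_fract [:c:])"

definition embed_eps :: "'a::field poly mpoly \<Rightarrow> 'a poly fract mpoly" where
  "embed_eps = Poly_Mapping.map to_fract"

definition VPe_closure :: "(nat \<Rightarrow> 'a::field mpoly) set" where
  "VPe_closure = {f \<in> families. \<exists>(fs :: nat \<Rightarrow> nat \<Rightarrow> 'a mpoly) (e :: nat \<Rightarrow> nat).
     (\<lambda>n. embed (f n) + (\<Sum>i = 1..e n. mconst (eps ^ i) * embed (fs n i))) \<in> VPe}"

section \<open>Border Fibonacci complexity\<close>

text \<open>
  The value of the polynomial \<open>F\<^sub>m\<close> at \<open>x 1, \<dots>, x m\<close> in an arbitrary commutative ring. The
  polynomial itself is obtained for \<open>x = mvar\<close>; the value \<open>x 0\<close> is not used.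
\<close>

fun fib_poly :: "nat \<Rightarrow> (nat \<Rightarrow> 'r::comm_ring_1) \<Rightarrow> 'r" where
  "fib_poly 0 x = 1"
| "fib_poly (Suc 0) x = x 1"
| "fib_poly (Suc (Suc m)) x = x (Suc (Suc m)) * fib_poly (Suc m) x + fib_poly m x"

definition affine_forms :: "'k::comm_ring_1 mpoly set" where
  "affine_forms = {l. \<exists>c a V. finite V \<and> l = mconst c + (\<Sum>i\<in>V. mconst (a i) * mvar i)}"

definition border_fib_computes :: "nat \<Rightarrow> 'a::field mpoly \<Rightarrow> bool" where
  "border_fib_computes m f \<longleftrightarrow>
     (\<exists>l :: nat \<Rightarrow> 'a poly fract mpoly. (\<forall>i\<in>{1..m}. l i \<in> affine_forms) \<and>
       fib_poly m l \<in> {embed f + mconst eps * embed_eps h | h. True})"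

text \<open>
  The least admissible \<open>m\<close>, which is \<open>\<infinity>\<close> if there is none (the infimum of the empty set).
\<close>

definition border_fib_complexity :: "'a::field mpoly \<Rightarrow> enat" where
  "border_fib_complexity f = (INF m\<in>{m. border_fib_computes m f}. enat m)"

end

theory Submission
  imports Defs
begin

text \<open>
  \<open>F\<^sub>m\<close> is the upper left entry of the product of the matrices \<open>M(x) = (x, 1; 1, 0)\<close> at \<open>x\<^sub>m, \<dots>, x\<^sub>1\<close>.
  Splitting such a product in the middle gives formulas of polynomial size, which is one inclusion,
  once the variables that do not occur in \<open>f\<^sub>n\<close> are set to 0.

  For the other one, a formula with \<open>s\<close> leaves is split recursively into formulas with at most
  \<open>s/2\<close> leaves. It then suffices to approximate \<open>M(c (f + g))\<close> and \<open>M(c f g)\<close> by a bounded number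
  of matrices \<open>M(c' f)\<close> and \<open>M(c' g)\<close>, with constants \<open>c'\<close> that may have poles at \<open>\<epsilon> = 0\<close>. For sums
  this is the identity \<open>M(f) M(0) M(g) = M(f + g)\<close>; for squares it is a commutator of unitriangular
  matrices, and \<open>4 f g = (f + g)^2 - (f - g)^2\<close> reduces products to squares. Errors are measured by
  congruence modulo \<open>\<epsilon>^N\<close> over the local ring at \<open>\<epsilon> = 0\<close>. The constants in the leaves are truncated
  to Laurent polynomials, so that the final error is a polynomial in \<open>\<epsilon>\<close>.
\<close>

section \<open>Matrices and continuants\<close>

datatype 'a mat2 = Mat2 (e11: 'a) (e12: 'a) (e21: 'a) (e22: 'a)

instantiation mat2 :: (comm_ring_1) monoid_mult
begin

definition one_mat2 :: "'a mat2" where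
  "one_mat2 = Mat2 1 0 0 1"

definition times_mat2 :: "'a mat2 \<Rightarrow> 'a mat2 \<Rightarrow> 'a mat2" where
  "times_mat2 A B = Mat2 (e11 A * e11 B + e12 A * e21 B) (e11 A * e12 B + e12 A * e22 B)
     (e21 A * e11 B + e22 A * e21 B) (e21 A * e12 B + e22 A * e22 B)"

instance
  by standard (simp_all add: one_mat2_def times_mat2_def algebra_simps)

end

lemma Mat2_mult [simp]:
  "Mat2 a b c d * Mat2 a' b' c' d' =
    Mat2 (a * a' + b * c') (a * b' + b * d') (c * a' + d * c') (c * b' + d * d')"
  by (simp add: times_mat2_def)

definition fib_mat :: "'a::comm_ring_1 \<Rightarrow> 'a mat2" where
  "fib_mat x = Mat2 x 1 1 0"

definition fib_prod :: "'a::comm_ring_1 list \<Rightarrow> 'a mat2" where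
  "fib_prod xs = prod_list (map fib_mat xs)"

lemma fib_prod_simps [simp]:
  "fib_prod [] = 1" "fib_prod (x # xs) = fib_mat x * fib_prod xs"
  "fib_prod (xs @ ys) = fib_prod xs * fib_prod ys"
  by (simp_all add: fib_prod_def)

text \<open>The lower left entry is carried along because the recursion for \<open>fib_poly\<close>
  looks two steps back. The value 0 at \<open>m = 0\<close> plays the role of \<open>F\<close> at
  -1.\<close>

lemma fib_prod_first_column:
  "e11 (fib_prod (map x (rev [1..<Suc m]))) = fib_poly m x \<and>
   e21 (fib_prod (map x (rev [1..<Suc m]))) = (if m = 0 then 0 else fib_poly (m - 1) x)"
proof (induction m)
  case 0
  then show ?case by (simp add: one_mat2_def)
next
  case (Suc m)
  then show ?case
    by (cases m) (auto simp: fib_mat_def times_mat2_def simp del: fib_prod_simps(3))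
qed

lemma fib_poly_eq_fib_prod: "fib_poly m x = e11 (fib_prod (map x (rev [1..<Suc m])))"
  using fib_prod_first_column[of x m] by simp

text \<open>Serves to read an arbitrary list as arguments of \<open>fib_poly\<close>. The leftmost
  matrix belongs to the last argument, hence \<open>rev\<close>; arguments are numbered from 1,
  hence \<open>i - 1\<close>.\<close>

lemma fib_prod_eq_fib_poly:
  "e11 (fib_prod xs) = fib_poly (length xs) (\<lambda>i. rev xs ! (i - 1))"
proof -
  have "map (\<lambda>i. rev xs ! (i - 1)) [1..<Suc (length xs)] = rev xs"
    by (rule nth_equalityI) (simp_all add: nth_append del: upt_Suc)
  then have "map (\<lambda>i. rev xs ! (i - 1)) (rev [1..<Suc (length xs)]) = xs"
    by (metis rev_map rev_rev_ident)
  then show ?thesis by (simp only: fib_poly_eq_fib_prod)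
qed

lemma fib_mat_add: "fib_mat f * fib_mat 0 * fib_mat g = fib_mat (f + g)"
  by (simp add: fib_mat_def algebra_simps)

text \<open>
  With \<open>U(x) = fib_mat x * fib_mat 0\<close> upper and \<open>L(y) = fib_mat 0 * fib_mat y\<close> lower unitriangular,
  the product below is the commutator of \<open>U(a)\<close> and \<open>L(b)\<close>, times \<open>fib_mat 0\<close>. It tends to
  \<open>fib_mat (- a^2 b)\<close> if \<open>a\<close> grows and \<open>b\<close> shrinks such that \<open>a b\<close> vanishes in the limit.
\<close>

lemma fib_mat_commutator:
  "fib_mat a * fib_mat b * fib_mat (- a) * fib_mat (- b) * fib_mat 0 =
     Mat2 (- (a ^ 2 * b)) (1 + a * b + a ^ 2 * b ^ 2) (1 - a * b) (a * b ^ 2)"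
  by (simp add: fib_mat_def algebra_simps power2_eq_square)

section \<open>Coefficients\<close>

lemma lookup_map_zero:
  "g 0 = 0 \<Longrightarrow> Poly_Mapping.lookup (Poly_Mapping.map g p) t = g (Poly_Mapping.lookup p t)"
  by (transfer) (auto simp: when_def)

lemma lookup_mconst_mult [simp]:
  fixes c :: "'k::comm_ring_1"
  shows "Poly_Mapping.lookup (mconst c * p) t = c * Poly_Mapping.lookup p t"
  unfolding mconst_def mult_map_scale_conv_mult [symmetric] by (simp add: lookup_map_zero)

lemma mconst_simps [simp]:
  "mconst 0 = 0" "mconst (1 :: 'k::comm_ring_1) = 1"
  "mconst (a + b) = mconst a + mconst (b :: 'k)"
  "mconst (a - b) = mconst a - mconst (b :: 'k)"
  "mconst (- a) = - mconst (a :: 'k)"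
  "mconst (a * b) = mconst a * mconst (b :: 'k)"
  by (simp_all add: mconst_def single_add single_diff single_uminus mult_single)

lemma finite_mvars [simp]: "finite (mvars p)"
  by (simp add: mvars_def)

text \<open>A predicate on sets lets \<open>local_ring\<close>, \<open>laurent\<close>,
  \<open>range to_fract\<close> and the polynomials with coefficients in one of these share the same
  closure lemmas.\<close>

definition subring_set :: "'k::comm_ring_1 set \<Rightarrow> bool" where
  "subring_set C \<longleftrightarrow> 1 \<in> C \<and> (\<forall>a\<in>C. \<forall>b\<in>C. a - b \<in> C \<and> a * b \<in> C)"

lemma subring_setD:
  assumes "subring_set C"
  shows "0 \<in> C" "1 \<in> C" "a \<in> C \<Longrightarrow> b \<in> C \<Longrightarrow> a - b \<in> C" "a \<in> C \<Longrightarrow> b \<in> C \<Longrightarrow> a * b \<in> C"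
    "a \<in> C \<Longrightarrow> b \<in> C \<Longrightarrow> a + b \<in> C" "a \<in> C \<Longrightarrow> - a \<in> C"
proof -
  show sub: "a - b \<in> C" if "a \<in> C" "b \<in> C" for a b
    using assms that by (simp add: subring_set_def)
  show one: "1 \<in> C"
    using assms by (simp add: subring_set_def)
  show zero: "0 \<in> C"
    using sub[OF one one] by simp
  show "a \<in> C \<Longrightarrow> b \<in> C \<Longrightarrow> a * b \<in> C"
    using assms by (simp add: subring_set_def)
  show minus: "- a \<in> C" if "a \<in> C" for a
    using sub[OF zero that] by simp
  show "a \<in> C \<Longrightarrow> b \<in> C \<Longrightarrow> a + b \<in> C"
    using sub[of a "- b"] minus[of b] by simp
qed

definition coeffs_in :: "'k::zero set \<Rightarrow> 'k mpoly set" where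
  "coeffs_in C = {p. \<forall>t. Poly_Mapping.lookup p t \<in> C}"

lemma sum_mem_subring_set: "subring_set C \<Longrightarrow> (\<And>x. f x \<in> C) \<Longrightarrow> sum f A \<in> C"
  by (induction A rule: infinite_finite_induct) (auto simp: subring_setD)

lemma mconst_mem_coeffs_in: "0 \<in> C \<Longrightarrow> c \<in> C \<Longrightarrow> mconst c \<in> coeffs_in C"
  by (auto simp: coeffs_in_def mconst_def lookup_single when_def)

lemma mconst_mult_mem_coeffs_in:
  "subring_set C \<Longrightarrow> c \<in> C \<Longrightarrow> p \<in> coeffs_in C \<Longrightarrow> mconst c * p \<in> coeffs_in C"
  by (simp add: coeffs_in_def subring_setD)

lemma mvar_mem_coeffs_in: "subring_set C \<Longrightarrow> mvar i \<in> coeffs_in C"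
  by (auto simp: coeffs_in_def mvar_def lookup_single when_def subring_setD)

lemma subring_set_coeffs_in:
  assumes "subring_set C"
  shows "subring_set (coeffs_in C)"
proof -
  have "1 \<in> coeffs_in C"
    using mconst_mem_coeffs_in[of C 1] assms by (simp add: subring_setD)
  moreover have "p * q \<in> coeffs_in C" if "p \<in> coeffs_in C" "q \<in> coeffs_in C" for p q
  proof -
    have "Poly_Mapping.lookup (p * q) t \<in> C" for t
      unfolding lookup_mult Sum_any.expand_set using that assms
      by (intro sum_mem_subring_set subring_setD(4)) (auto simp: coeffs_in_def when_def subring_setD)
    then show ?thesis by (simp add: coeffs_in_def)
  qed
  ultimately show ?thesis
    using assms by (auto simp: subring_set_def coeffs_in_def lookup_minus)
qed

section \<open>The \<open>\<epsilon>\<close>-adic topology\<close>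

text \<open>The localization of the polynomial ring in \<open>eps\<close> at the prime ideal
  generated by \<open>eps\<close>: fractions without a pole at 0.\<close>

definition local_ring :: "'a::field poly fract set" where
  "local_ring = {to_fract a / to_fract b | a b. poly b 0 \<noteq> 0}"

text \<open>The coefficients allowed in the approximating forms. Such a fraction can only have a
  pole at 0, so being regular there makes it a polynomial.\<close>

definition laurent :: "'a::field poly fract set" where
  "laurent = {to_fract a / eps ^ k | a k. True}"

lemma eps_nonzero [simp]: "eps \<noteq> 0"
  by (simp add: eps_def)

lemma eps_power: "eps ^ k = to_fract ([:0, 1:] ^ k)"
  by (induction k) (simp_all add: eps_def del: mult_pCons_left)

lemma subring_set_local_ring: "subring_set (local_ring :: 'a::field poly fract set)"
  unfolding subring_set_def
proof (intro conjI ballI)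
  have "(1 :: 'a poly fract) = to_fract 1 / to_fract 1" by simp
  then show "1 \<in> (local_ring :: 'a poly fract set)"
    unfolding local_ring_def by (metis (mono_tags, lifting) mem_Collect_eq poly_1 zero_neq_one)
next
  fix x y :: "'a poly fract" assume "x \<in> local_ring" "y \<in> local_ring"
  then obtain a b c d where x: "x = to_fract a / to_fract b" "poly b 0 \<noteq> 0"
    and y: "y = to_fract c / to_fract d" "poly d 0 \<noteq> 0"
    by (auto simp: local_ring_def)
  then have [simp]: "b \<noteq> 0" "d \<noteq> 0" by auto
  have "x - y = to_fract (a * d - b * c) / to_fract (b * d)"
    by (simp add: x y field_simps)
  then show "x - y \<in> local_ring"
    unfolding local_ring_def using x y by (metis (mono_tags, lifting) mem_Collect_eq mult_eq_0_iff poly_mult)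
  have "x * y = to_fract (a * c) / to_fract (b * d)"
    by (simp add: x y)
  then show "x * y \<in> local_ring"
    unfolding local_ring_def using x y by (metis (mono_tags, lifting) mem_Collect_eq mult_eq_0_iff poly_mult)
qed

lemma subring_set_laurent: "subring_set (laurent :: 'a::field poly fract set)"
  unfolding subring_set_def
proof (intro conjI ballI)
  have "(1 :: 'a poly fract) = to_fract 1 / eps ^ 0" by simp
  then show "1 \<in> (laurent :: 'a poly fract set)" unfolding laurent_def by blast
next
  fix x y :: "'a poly fract" assume "x \<in> laurent" "y \<in> laurent"
  then obtain a b c d where x: "x = to_fract a / eps ^ b" and y: "y = to_fract c / eps ^ d"
    by (auto simp: laurent_def)
  have "x - y = to_fract (a * [:0, 1:] ^ d - c * [:0, 1:] ^ b) / eps ^ (b + d)"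
    by (simp add: x y field_simps power_add flip: eps_power del: mult_pCons_left mult_pCons_right)
  then show "x - y \<in> laurent" unfolding laurent_def by blast
  have "x * y = to_fract (a * c) / eps ^ (b + d)"
    by (simp add: x y power_add)
  then show "x * y \<in> laurent" unfolding laurent_def by blast
qed

lemma to_fract_mem_local_ring: "to_fract a \<in> local_ring"
proof -
  have "to_fract a = to_fract a / to_fract 1" by simp
  then show ?thesis
    unfolding local_ring_def by (metis (mono_tags, lifting) mem_Collect_eq poly_1 zero_neq_one)
qed

lemma to_fract_mem_laurent: "to_fract a \<in> laurent"
proof -
  have "to_fract a = to_fract a / eps ^ 0" by simp
  then show ?thesis unfolding laurent_def by blast
qed

lemma eps_power_mem_local_ring: "eps ^ k \<in> local_ring"
  by (simp add: eps_power to_fract_mem_local_ring)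

text \<open>A polynomial with nonzero constant term is invertible modulo every power of
  \<open>eps\<close>.\<close>

lemma monomial_bezout:
  fixes b :: "'a::field poly"
  assumes "poly b 0 \<noteq> 0"
  shows "\<exists>u v. u * b + v * [:0, 1:] ^ k = 1"
proof (induction k)
  case 0
  have "0 * b + 1 * [:0, 1:] ^ 0 = 1" by simp
  then show ?case by blast
next
  case (Suc k)
  then obtain u v where uv: "u * b + v * [:0, 1:] ^ k = 1" by blast
  \<comment> \<open>The constant \<open>w\<close> is chosen such that \<open>v - w * b\<close>
    vanishes at 0. One more factor \<open>eps\<close> can then be split off, and \<open>u\<close>
    absorbs the correction.\<close>
  define w where "w = [:poly v 0 / poly b 0:]"
  have "poly (v - w * b) 0 = 0"
    using assms by (simp add: w_def)
  then obtain v' where v': "v - w * b = [:0, 1:] * v'"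
    unfolding poly_eq_0_iff_dvd by (metis dvdE minus_zero)
  have "(u + w * [:0, 1:] ^ k) * b + v' * [:0, 1:] ^ Suc k =
      u * b + w * [:0, 1:] ^ k * b + ([:0, 1:] * v') * [:0, 1:] ^ k"
    by (simp only: power_Suc algebra_simps)
  also have "\<dots> = 1"
    unfolding v' [symmetric] uv [symmetric] by (simp only: algebra_simps)
  finally show ?case by blast
qed

lemma monomial_dvd_cancel:
  fixes a b :: "'a::field poly"
  assumes "poly b 0 \<noteq> 0" and "[:0, 1:] ^ k dvd a * b"
  shows "[:0, 1:] ^ k dvd a"
proof -
  obtain u v where "u * b + v * [:0, 1:] ^ k = 1"
    using monomial_bezout[OF assms(1)] by blast
  then have "a = a * (u * b + v * [:0, 1:] ^ k)" by simp
  also have "\<dots> = u * (a * b) + a * v * [:0, 1:] ^ k"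
    by (simp only: algebra_simps)
  also have "[:0, 1:] ^ k dvd \<dots>"
    by (rule dvd_add[OF dvd_mult[OF assms(2)] dvd_triv_right])
  finally show ?thesis .
qed

text \<open>Comparing the two representations shows that \<open>eps ^ k\<close> divides
  \<open>p * b\<close>; as \<open>b\<close> is prime to \<open>eps\<close>, it divides
  \<open>p\<close>.\<close>

lemma laurent_Int_local_ring:
  fixes c :: "'a::field poly fract"
  assumes "c \<in> laurent" "c \<in> local_ring"
  shows "c \<in> range to_fract"
proof -
  obtain p k where p: "c = to_fract p / eps ^ k"
    using assms by (auto simp: laurent_def)
  obtain a b where ab: "c = to_fract a / to_fract b" "poly b 0 \<noteq> 0"
    using assms by (auto simp: local_ring_def)
  then have [simp]: "b \<noteq> 0" by auto
  have "to_fract (p * b) = to_fract (a * [:0, 1:] ^ k)"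
    using p ab
    by (simp add: field_simps flip: eps_power del: mult_pCons_left mult_pCons_right)
  then have "p * b = a * [:0, 1:] ^ k" by (simp only: to_fract_eq_iff)
  then have "[:0, 1:] ^ k dvd p"
    using monomial_dvd_cancel[OF ab(2), of k p] by simp
  then obtain r where "p = [:0, 1:] ^ k * r" by blast
  then have "c = to_fract r"
    using p by (simp flip: eps_power del: mult_pCons_left mult_pCons_right)
  then show ?thesis by simp
qed

lemma fract_cases_eps:
  fixes c :: "'a::field poly fract"
  obtains a b k where "poly b 0 \<noteq> 0" "c = to_fract a / (to_fract b * eps ^ k)"
proof -
  obtain a d where c: "c = to_fract a / to_fract d" and "d \<noteq> 0"
    by (cases c) (auto simp: Fract_conv_to_fract)
  then obtain b where b: "d = [:- 0, 1:] ^ order 0 d * b" "\<not> [:- 0, 1:] dvd b"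
    using order_decomp by blast
  have "poly b 0 \<noteq> 0"
    using b(2) poly_eq_0_iff_dvd by blast
  moreover have "to_fract d = to_fract b * eps ^ order 0 d"
    by (subst b(1)) (simp add: eps_power)
  ultimately show ?thesis
    using that c by metis
qed

text \<open>The factor of the denominator that is prime to \<open>eps\<close> is replaced by
  multiplication with its inverse \<open>u\<close> modulo \<open>eps ^ (N + k)\<close>. The extra
  \<open>k\<close> makes up for the pole of \<open>c\<close>.\<close>

lemma laurent_approximation:
  fixes c :: "'a::field poly fract"
  shows "\<exists>c'\<in>laurent. \<exists>r\<in>local_ring. c' - c = eps ^ N * r"
proof -
  obtain a b k where b: "poly b 0 \<noteq> 0" and c: "c = to_fract a / (to_fract b * eps ^ k)"
    by (rule fract_cases_eps)
  have [simp]: "b \<noteq> 0" using b by auto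
  obtain u v where "u * b + v * [:0, 1:] ^ (N + k) = 1"
    using monomial_bezout[OF b] by blast
  then have "to_fract (u * b + v * [:0, 1:] ^ (N + k)) = 1" by simp
  then have uv: "to_fract u * to_fract b - 1 = - to_fract v * eps ^ (N + k)"
    by (simp add: eps_power algebra_simps del: mult_pCons_left mult_pCons_right)
  have "to_fract (a * u) / eps ^ k - c =
      to_fract a * (to_fract u * to_fract b - 1) / (to_fract b * eps ^ k)"
    by (simp add: c field_simps)
  also have "\<dots> = eps ^ N * (to_fract (- (a * v)) / to_fract b)"
    by (simp add: uv power_add)
  finally have "to_fract (a * u) / eps ^ k - c = eps ^ N * (to_fract (- (a * v)) / to_fract b)" .
  moreover have "to_fract (a * u) / eps ^ k \<in> laurent"
    unfolding laurent_def by blast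
  moreover have "to_fract (- (a * v)) / to_fract b \<in> local_ring"
    unfolding local_ring_def using b by blast
  ultimately show ?thesis by blast
qed

lemma eps_power_mult_mem_local_ring: "\<exists>k. eps ^ k * c \<in> local_ring"
proof -
  obtain a b k where b: "poly b 0 \<noteq> 0" and c: "c = to_fract a / (to_fract b * eps ^ k)"
    by (rule fract_cases_eps)
  have "eps ^ k * c = to_fract a / to_fract b"
    by (simp add: c)
  then show ?thesis
    using b unfolding local_ring_def by blast
qed

lemmas subring_set_local_coeffs = subring_set_coeffs_in[OF subring_set_local_ring]

lemma eps_power_mult_mem_local_coeffs:
  "\<exists>K. \<forall>k\<ge>K. mconst (eps ^ k) * p \<in> coeffs_in local_ring"
proof -
  have "\<forall>t. \<exists>k. eps ^ k * Poly_Mapping.lookup p t \<in> local_ring"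
    using eps_power_mult_mem_local_ring by blast
  then obtain k where k: "eps ^ k t * Poly_Mapping.lookup p t \<in> local_ring" for t
    by metis
  \<comment> \<open>The sum is a convenient upper bound for the finitely many pole orders.\<close>
  define K where "K = (\<Sum>t\<in>Poly_Mapping.keys p. k t)"
  have "eps ^ m * Poly_Mapping.lookup p t \<in> local_ring" if m: "m \<ge> K" for m t
  proof (cases "t \<in> Poly_Mapping.keys p")
    case True
    then have "k t \<le> K" by (simp add: K_def member_le_sum)
    then have "eps ^ m * Poly_Mapping.lookup p t =
        eps ^ (m - k t) * (eps ^ k t * Poly_Mapping.lookup p t)"
      using m by (simp flip: power_add mult.assoc)
    then show ?thesis
      using k[of t] subring_setD(4)[OF subring_set_local_ring eps_power_mem_local_ring]
      by metis
  next
    case False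
    then show ?thesis
      by (simp add: in_keys_iff subring_setD(1)[OF subring_set_local_ring])
  qed
  then show ?thesis by (auto simp: coeffs_in_def)
qed

text \<open>Both polynomials may have poles at \<open>eps\<close> = 0; only their difference has to
  be small. Hence this is not a congruence of rings, and products need more precision in the
  factors.\<close>

definition eps_cong :: "nat \<Rightarrow> 'a::field poly fract mpoly \<Rightarrow> 'a poly fract mpoly \<Rightarrow> bool" where
  "eps_cong N p q \<longleftrightarrow> (\<exists>r\<in>coeffs_in local_ring. p - q = mconst (eps ^ N) * r)"

lemma eps_cong_refl [simp]: "eps_cong N p p"
  unfolding eps_cong_def using subring_setD(1)[OF subring_set_local_coeffs] by force

lemma eps_cong_trans: "eps_cong N p q \<Longrightarrow> eps_cong N q r \<Longrightarrow> eps_cong N p r"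
proof -
  assume "eps_cong N p q" "eps_cong N q r"
  then obtain s t where "s \<in> coeffs_in local_ring" "p - q = mconst (eps ^ N) * s"
    "t \<in> coeffs_in local_ring" "q - r = mconst (eps ^ N) * t"
    unfolding eps_cong_def by blast
  moreover from this have "p - r = mconst (eps ^ N) * (s + t)"
    by (simp add: algebra_simps)
  ultimately show ?thesis
    unfolding eps_cong_def using subring_setD(5)[OF subring_set_local_coeffs] by blast
qed

lemma eps_cong_add:
  "eps_cong N p p' \<Longrightarrow> eps_cong N q q' \<Longrightarrow> eps_cong N (p + q) (p' + q')"
proof -
  assume "eps_cong N p p'" "eps_cong N q q'"
  then obtain s t where "s \<in> coeffs_in local_ring" "p - p' = mconst (eps ^ N) * s"
    "t \<in> coeffs_in local_ring" "q - q' = mconst (eps ^ N) * t"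
    unfolding eps_cong_def by blast
  moreover from this have "p + q - (p' + q') = mconst (eps ^ N) * (s + t)"
    by (simp add: algebra_simps)
  ultimately show ?thesis
    unfolding eps_cong_def using subring_setD(5)[OF subring_set_local_coeffs] by blast
qed

lemma eps_cong_mono:
  assumes "eps_cong N p q" "M \<le> N"
  shows "eps_cong M p q"
proof -
  obtain s where s: "s \<in> coeffs_in local_ring" "p - q = mconst (eps ^ N) * s"
    using assms unfolding eps_cong_def by blast
  have "eps ^ N = eps ^ M * (eps ^ (N - M) :: 'a poly fract)"
    using assms(2) by (simp flip: power_add)
  then have "p - q = mconst (eps ^ M) * (mconst (eps ^ (N - M)) * s)"
    by (simp add: s(2) mult.assoc)
  then show ?thesis
    unfolding eps_cong_def
    using mconst_mult_mem_coeffs_in[OF subring_set_local_ring eps_power_mem_local_ring s(1)] by blast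
qed

lemma eps_cong_add_null:
  assumes "eps_cong N d 0"
  shows "eps_cong N (p + d) p"
  using eps_cong_add[OF eps_cong_refl assms, of p] by simp

lemma eps_cong_null:
  "\<exists>K. \<forall>k\<ge>K. eps_cong N (mconst (eps ^ k) * p) 0"
proof -
  obtain K where K: "\<And>k. k \<ge> K \<Longrightarrow> mconst (eps ^ k) * p \<in> coeffs_in local_ring"
    using eps_power_mult_mem_local_coeffs by blast
  have "eps_cong N (mconst (eps ^ k) * p) 0" if "k \<ge> N + K" for k
  proof -
    have "mconst (eps ^ k) * p = mconst (eps ^ N) * (mconst (eps ^ (k - N)) * p)"
      using that by (simp flip: mult.assoc mconst_simps power_add)
    then show ?thesis
      unfolding eps_cong_def using K[of "k - N"] that by force
  qed
  then show ?thesis by blast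
qed

text \<open>Continuity of multiplication at a fixed pair. Poles of \<open>p\<close> and
  \<open>q\<close> magnify the error of the other factor, so the required precision depends on
  \<open>p\<close> and \<open>q\<close>; adding their pole orders to \<open>N\<close> is
  enough.\<close>

lemma eps_cong_mult:
  "\<exists>K. \<forall>p' q'. eps_cong K p' p \<longrightarrow> eps_cong K q' q \<longrightarrow> eps_cong N (p' * q') (p * q)"
proof -
  obtain K where K: "mconst (eps ^ K) * p \<in> coeffs_in local_ring"
    using eps_power_mult_mem_local_coeffs by blast
  obtain L where L: "mconst (eps ^ L) * q \<in> coeffs_in local_ring"
    using eps_power_mult_mem_local_coeffs by blast
  have "eps_cong N (p' * q') (p * q)"
    if "eps_cong (N + K + L) p' p" "eps_cong (N + K + L) q' q" for p' q'
  proof -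
    obtain r s where r: "r \<in> coeffs_in local_ring" "p' - p = mconst (eps ^ (N + K + L)) * r"
      and s: "s \<in> coeffs_in local_ring" "q' - q = mconst (eps ^ (N + K + L)) * s"
      using \<open>eps_cong (N + K + L) p' p\<close> \<open>eps_cong (N + K + L) q' q\<close>
      unfolding eps_cong_def by blast
    define e where "e i = (mconst (eps ^ i) :: 'a poly fract mpoly)" for i
    have e_add: "e (i + j) = e i * e j" for i j by (simp add: e_def power_add)
    have "p' * q' - p * q = p * (q' - q) + (p' - p) * q + (p' - p) * (q' - q)"
      by (simp add: algebra_simps)
    also have "\<dots> = e N * (e L * (e K * p * s) + e K * (e L * q * r) + e (N + K + L + K + L) * (r * s))"
      by (simp only: r s e_def [symmetric]) (simp add: e_add algebra_simps)
    finally have "p' * q' - p * q =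
        e N * (e L * (e K * p * s) + e K * (e L * q * r) + e (N + K + L + K + L) * (r * s))" .
    moreover have "e L * (e K * p * s) + e K * (e L * q * r) + e (N + K + L + K + L) * (r * s)
        \<in> coeffs_in local_ring"
      proof -
      have e_mult: "e i * x \<in> coeffs_in local_ring" if "x \<in> coeffs_in local_ring" for i x
        unfolding e_def
        by (rule mconst_mult_mem_coeffs_in[OF subring_set_local_ring eps_power_mem_local_ring that])
      note mem = subring_setD(4,5)[OF subring_set_local_coeffs]
      show ?thesis
        using mem(1)[OF K s(1)] mem(1)[OF L r(1)] mem(1)[OF r(1) s(1)]
        unfolding e_def [symmetric] by (intro mem(2) e_mult)
    qed
    ultimately show ?thesis
      unfolding eps_cong_def e_def by blast
  qed
  then show ?thesis by blast
qed

definition mat_cong :: "nat \<Rightarrow> 'a::field poly fract mpoly mat2 \<Rightarrow> 'a poly fract mpoly mat2 \<Rightarrow> bool"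
  where "mat_cong N = rel_mat2 (eps_cong N)"

lemma mat_cong_Mat2 [simp]:
  "mat_cong N (Mat2 a b c d) (Mat2 a' b' c' d') \<longleftrightarrow>
     eps_cong N a a' \<and> eps_cong N b b' \<and> eps_cong N c c' \<and> eps_cong N d d'"
  by (simp add: mat_cong_def)

lemma mat_cong_trans: "mat_cong N A B \<Longrightarrow> mat_cong N B C \<Longrightarrow> mat_cong N A C"
  by (cases A; cases B; cases C) (auto intro: eps_cong_trans)

lemma mat_cong_mult:
  "\<exists>K. \<forall>A' B'. mat_cong K A' A \<longrightarrow> mat_cong K B' B \<longrightarrow> mat_cong N (A' * B') (A * B)"
proof -
  \<comment> \<open>Each pair of entries has its own precision. There are finitely many pairs, so
    the sum of these precisions works for all of them.\<close>
  have "\<exists>k. \<forall>p q. \<forall>p' q'. p \<in> set_mat2 A \<longrightarrow> q \<in> set_mat2 B \<longrightarrow>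
      eps_cong k p' p \<longrightarrow> eps_cong k q' q \<longrightarrow> eps_cong N (p' * q') (p * q)"
  proof -
    obtain k where k: "\<And>p q p' q' :: 'a poly fract mpoly.
        eps_cong (k p q) p' p \<Longrightarrow> eps_cong (k p q) q' q \<Longrightarrow> eps_cong N (p' * q') (p * q)"
      using eps_cong_mult[of _ _ N] by metis
    have fin: "finite (set_mat2 M)" for M :: "'a poly fract mpoly mat2"
      by (cases M) simp
    have "k p q \<le> (\<Sum>p\<in>set_mat2 A. \<Sum>q\<in>set_mat2 B. k p q)"
      if "p \<in> set_mat2 A" "q \<in> set_mat2 B" for p q
    proof -
      have "k p q \<le> (\<Sum>q\<in>set_mat2 B. k p q)"
        using that fin by (intro member_le_sum) auto
      also have "\<dots> \<le> (\<Sum>p\<in>set_mat2 A. \<Sum>q\<in>set_mat2 B. k p q)"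
        using that fin by (intro member_le_sum) auto
      finally show ?thesis .
    qed
    then show ?thesis
      by (intro exI[of _ "\<Sum>p\<in>set_mat2 A. \<Sum>q\<in>set_mat2 B. k p q"]) (blast intro: k eps_cong_mono)
  qed
  then obtain k where k: "\<And>p q p' q'. p \<in> set_mat2 A \<Longrightarrow> q \<in> set_mat2 B \<Longrightarrow>
      eps_cong k p' p \<Longrightarrow> eps_cong k q' q \<Longrightarrow> eps_cong N (p' * q') (p * q)"
    by blast
  have "mat_cong N (A' * B') (A * B)" if "mat_cong k A' A" "mat_cong k B' B" for A' B'
    using that by (cases A; cases B; cases A'; cases B') (auto intro!: eps_cong_add k)
  then show ?thesis by blast
qed

section \<open>Approximation by products of Fibonacci matrices\<close>

text \<open>The \<open>eps\<close>-adic closure of the products of at most \<open>m\<close>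
  Fibonacci matrices. The list may change with \<open>N\<close>, and restricting it to Laurent
  coefficients is what later makes the error a polynomial in \<open>eps\<close>.\<close>

definition fib_closure :: "nat \<Rightarrow> 'a::field poly fract mpoly mat2 set" where
  "fib_closure m = {A. \<forall>N. \<exists>xs. length xs \<le> m \<and> set xs \<subseteq> affine_forms \<inter> coeffs_in laurent \<and>
     mat_cong N (fib_prod xs) A}"

lemma fib_closure_mono: "A \<in> fib_closure m \<Longrightarrow> m \<le> n \<Longrightarrow> A \<in> fib_closure n"
  unfolding fib_closure_def mem_Collect_eq by (meson order_trans)

lemma fib_closure_mult:
  assumes "A \<in> fib_closure m" "B \<in> fib_closure n"
  shows "A * B \<in> fib_closure (m + n)"
  unfolding fib_closure_def
proof safe
  fix N
  obtain K where K: "\<And>A' B'. mat_cong K A' A \<Longrightarrow> mat_cong K B' B \<Longrightarrow> mat_cong N (A' * B') (A * B)"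
    using mat_cong_mult by blast
  obtain xs where xs: "length xs \<le> m" "set xs \<subseteq> affine_forms \<inter> coeffs_in laurent"
      "mat_cong K (fib_prod xs) A"
    using assms unfolding fib_closure_def by blast
  obtain ys where ys: "length ys \<le> n" "set ys \<subseteq> affine_forms \<inter> coeffs_in laurent"
      "mat_cong K (fib_prod ys) B"
    using assms unfolding fib_closure_def by blast
  show "\<exists>xs. length xs \<le> m + n \<and> set xs \<subseteq> affine_forms \<inter> coeffs_in laurent \<and>
      mat_cong N (fib_prod xs) (A * B)"
    using xs ys K by (intro exI[of _ "xs @ ys"]) auto
qed

text \<open>The closure is closed. Approximations can therefore be nested without increasing the
  number of matrices.\<close>

lemma fib_closure_limit:
  assumes "\<And>N. \<exists>A\<in>fib_closure m. mat_cong N A B"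
  shows "B \<in> fib_closure m"
  using assms unfolding fib_closure_def by (blast intro: mat_cong_trans)

section \<open>Constants and multiples of variables\<close>

lemma affine_formsI: "finite V \<Longrightarrow> mconst c + (\<Sum>i\<in>V. mconst (a i) * mvar i) \<in> affine_forms"
  unfolding affine_forms_def mem_Collect_eq
  by (rule exI[of _ c], rule exI[of _ a], rule exI[of _ V]) simp

lemma affine_forms_mconst: "mconst c \<in> affine_forms"
proof -
  have "mconst c + (\<Sum>i\<in>{}. mconst 0 * mvar i) \<in> affine_forms" by (rule affine_formsI) simp
  then show ?thesis by simp
qed

lemma affine_forms_mconst_mult_mvar:
  "mconst c * mvar i \<in> (affine_forms :: 'k::comm_ring_1 mpoly set)"
proof -
  have "mconst 0 + (\<Sum>i\<in>{i}. mconst c * mvar i :: 'k mpoly) \<in> affine_forms"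
    by (rule affine_formsI) simp
  then show ?thesis by simp
qed

text \<open>Treats \<open>x = 1\<close> and \<open>x = mvar i\<close> together: their coefficients
  lie in every subring, so replacing \<open>c\<close> by a nearby Laurent polynomial causes an error
  of the same order.\<close>

lemma fib_mat_mconst_mult_mem_fib_closure:
  assumes "\<And>c. mconst c * x \<in> affine_forms" "\<And>C. subring_set C \<Longrightarrow> x \<in> coeffs_in C"
  shows "fib_mat (mconst c * x) \<in> fib_closure 1"
  unfolding fib_closure_def
proof safe
  fix N
  obtain c' r where c': "c' \<in> laurent" and r: "r \<in> local_ring" "c' - c = eps ^ N * r"
    using laurent_approximation by blast
  have "mconst c' * x \<in> coeffs_in laurent"
    using mconst_mult_mem_coeffs_in[OF subring_set_laurent c'] assms(2) subring_set_laurent by blast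
  moreover have "mconst c' * x - mconst c * x = mconst (eps ^ N) * (mconst r * x)"
    by (metis r(2) left_diff_distrib mconst_simps(4,6) mult.assoc)
  then have "eps_cong N (mconst c' * x) (mconst c * x)"
    unfolding eps_cong_def
    using mconst_mult_mem_coeffs_in[OF subring_set_local_ring r(1)] assms(2) subring_set_local_ring
    by blast
  ultimately show "\<exists>xs. length xs \<le> 1 \<and> set xs \<subseteq> affine_forms \<inter> coeffs_in laurent \<and>
      mat_cong N (fib_prod xs) (fib_mat (mconst c * x))"
    using assms(1) by (intro exI[of _ "[mconst c' * x]"]) (auto simp: fib_mat_def)
qed

lemma fib_mat_mconst_mem_fib_closure: "fib_mat (mconst c) \<in> fib_closure 1"
  using fib_mat_mconst_mult_mem_fib_closure[of 1 c] affine_forms_mconst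
    subring_setD(2)[OF subring_set_coeffs_in] by auto

definition fib_approximable :: "nat \<Rightarrow> 'a::field poly fract mpoly \<Rightarrow> bool" where
  "fib_approximable m f \<longleftrightarrow> (\<forall>c. fib_mat (mconst c * f) \<in> fib_closure m)"

lemma fib_approximable_mono: "fib_approximable m f \<Longrightarrow> m \<le> n \<Longrightarrow> fib_approximable n f"
  unfolding fib_approximable_def using fib_closure_mono by blast

lemma fib_approximable_mvar: "fib_approximable 1 (mvar i)"
  unfolding fib_approximable_def
  using fib_mat_mconst_mult_mem_fib_closure affine_forms_mconst_mult_mvar mvar_mem_coeffs_in by blast

lemma fib_approximable_mconst: "fib_approximable 1 (mconst c)"
  unfolding fib_approximable_def using fib_mat_mconst_mem_fib_closure
  by (metis mconst_simps(6))

section \<open>Sums, squares and products of approximable polynomials\<close>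

lemma fib_approximable_scale: "fib_approximable m f \<Longrightarrow> fib_approximable m (mconst a * f)"
  unfolding fib_approximable_def by (metis mconst_simps(6) mult.assoc)

lemma fib_approximable_uminus: "fib_approximable m f \<Longrightarrow> fib_approximable m (- f)"
  using fib_approximable_scale[of m f "- 1"] by simp

lemma fib_approximable_add:
  assumes "fib_approximable m f" "fib_approximable n g"
  shows "fib_approximable (m + n + 1) (f + g)"
  unfolding fib_approximable_def
proof
  fix c
  have "fib_mat (mconst c * f) * fib_mat (mconst 0) * fib_mat (mconst c * g) \<in> fib_closure (m + 1 + n)"
    using assms unfolding fib_approximable_def
    by (intro fib_closure_mult fib_mat_mconst_mem_fib_closure) auto
  then show "fib_mat (mconst c * (f + g)) \<in> fib_closure (m + n + 1)"
    by (simp add: fib_mat_add distrib_left add_ac)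
qed

lemma fib_approximable_diff:
  "fib_approximable m f \<Longrightarrow> fib_approximable n g \<Longrightarrow> fib_approximable (m + n + 1) (f - g)"
  using fib_approximable_add[of m f n "- g"] fib_approximable_uminus by auto

text \<open>The commutator is used with \<open>a = f / eps ^ k\<close> and
  \<open>b = - c * eps ^ (2 * k)\<close>. Then \<open>- (a ^ 2 * b)\<close> is exactly
  \<open>c * f ^ 2\<close>, while \<open>a * b\<close>, \<open>a ^ 2 * b ^ 2\<close> and
  \<open>a * b ^ 2\<close> carry the factors \<open>eps ^ k\<close>, \<open>eps ^ (2 * k)\<close>
  and \<open>eps ^ (3 * k)\<close>. Two of the five matrices cost \<open>m\<close> each; the other
  three are constant.\<close>

lemma fib_approximable_square:
  assumes "fib_approximable m f"
  shows "fib_approximable (2 * m + 3) (f ^ 2)"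
  unfolding fib_approximable_def
proof (intro allI fib_closure_limit)
  fix c and N :: nat
  \<comment> \<open>Since \<open>f\<close> and \<open>c\<close> may have poles, each error term has
    its own threshold for \<open>k\<close>. \<open>K1\<close> and \<open>K4\<close> serve the two
    signs of \<open>a * b\<close>.\<close>
  obtain K1 where K1: "\<And>k. k \<ge> K1 \<Longrightarrow> eps_cong N (mconst (eps ^ k) * (mconst (- c) * f)) 0"
    using eps_cong_null by blast
  obtain K2 where K2: "\<And>k. k \<ge> K2 \<Longrightarrow> eps_cong N (mconst (eps ^ k) * (mconst (c ^ 2) * f ^ 2)) 0"
    using eps_cong_null by blast
  obtain K3 where K3: "\<And>k. k \<ge> K3 \<Longrightarrow> eps_cong N (mconst (eps ^ k) * (mconst (c ^ 2) * f)) 0"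
    using eps_cong_null by blast
  obtain K4 where K4: "\<And>k. k \<ge> K4 \<Longrightarrow> eps_cong N (mconst (eps ^ k) * (mconst c * f)) 0"
    using eps_cong_null by blast
  define k where "k = K1 + K2 + K3 + K4"
  define a where "a = mconst (1 / eps ^ k) * f"
  define b where "b = (mconst (- c * eps ^ (2 * k)) :: 'a poly fract mpoly)"
  have scalar: "mconst u * x = mconst v * x" if "u = v" for u v :: "'a poly fract" and x
    using that by simp
  have eps2: "eps ^ (2 * k) = eps ^ k * (eps ^ k :: 'a poly fract)"
    and eps3: "eps ^ (3 * k) = eps ^ k * (eps ^ k * (eps ^ k :: 'a poly fract))"
    by (simp_all add: mult_2 numeral_3_eq_3 power_add)
  have ab: "a * b = mconst (eps ^ k) * (mconst (- c) * f)"
  proof -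
    have "a * b = mconst (1 / eps ^ k * (- c * eps ^ (2 * k))) * f"
      unfolding a_def b_def mconst_simps(6) by (simp only: mult_ac)
    also have "\<dots> = mconst (eps ^ k * - c) * f"
      unfolding eps2 by (rule scalar) simp
    finally show ?thesis by (simp only: mconst_simps(6) mult.assoc)
  qed
  have aab: "a ^ 2 * b = - (mconst c * f ^ 2)"
  proof -
    have "a ^ 2 * b = mconst (1 / eps ^ k * (1 / eps ^ k * (- c * eps ^ (2 * k)))) * f ^ 2"
      unfolding a_def b_def mconst_simps(6) power2_eq_square by (simp only: mult_ac)
    also have "\<dots> = mconst (- c) * f ^ 2"
      unfolding eps2 by (rule scalar) simp
    finally show ?thesis by simp
  qed
  have aabb: "a ^ 2 * b ^ 2 = mconst (eps ^ (2 * k)) * (mconst (c ^ 2) * f ^ 2)"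
    unfolding power_mult_distrib [symmetric] ab
    unfolding eps2 by (simp add: power2_eq_square mult_ac)
  have abb: "a * b ^ 2 = mconst (eps ^ (3 * k)) * (mconst (c ^ 2) * f)"
  proof -
    have "a * b ^ 2 = mconst (eps ^ k) * (mconst (- c) * f) * b"
      by (simp only: ab [symmetric] power2_eq_square mult.assoc)
    also have "\<dots> = mconst (eps ^ k * - c * (- c * eps ^ (2 * k))) * f"
      unfolding b_def mconst_simps(6) by (simp only: mult_ac)
    also have "\<dots> = mconst (eps ^ (3 * k) * c ^ 2) * f"
      unfolding eps2 eps3 by (rule scalar) (simp add: power2_eq_square)
    finally show ?thesis by (simp only: mconst_simps(6) mult.assoc)
  qed
  define A where "A = fib_mat a * fib_mat b * fib_mat (- a) * fib_mat (- b) * fib_mat 0"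
  have f: "fib_mat a \<in> fib_closure m" "fib_mat (- a) \<in> fib_closure m"
    using assms fib_approximable_uminus[OF assms] unfolding fib_approximable_def a_def by auto
  have const: "fib_mat b \<in> fib_closure 1" "fib_mat (- b) \<in> fib_closure 1" "fib_mat 0 \<in> fib_closure 1"
    using fib_mat_mconst_mem_fib_closure unfolding b_def by (metis mconst_simps(1,5))+
  have "A \<in> fib_closure (m + 1 + m + 1 + 1)"
    unfolding A_def by (intro fib_closure_mult f const)
  then have "A \<in> fib_closure (2 * m + 3)"
    by (rule fib_closure_mono) simp
  moreover have "mat_cong N A (fib_mat (mconst c * f ^ 2))"
  proof -
    have "eps_cong N (1 + a * b + a ^ 2 * b ^ 2) (1 + a * b)"
      unfolding aabb by (intro eps_cong_add_null K2) (simp add: k_def)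
    moreover have "eps_cong N (1 + a * b) 1"
      unfolding ab by (intro eps_cong_add_null K1) (simp add: k_def)
    moreover have "eps_cong N (1 - a * b) 1"
      using eps_cong_add_null[OF K4[of k], of 1] unfolding ab by (simp add: k_def)
    moreover have "eps_cong N (a * b ^ 2) 0"
      unfolding abb by (intro K3) (simp add: k_def)
    ultimately show ?thesis
      unfolding A_def fib_mat_commutator by (auto simp: fib_mat_def aab intro: eps_cong_trans)
  qed
  ultimately show "\<exists>A\<in>fib_closure (2 * m + 3). mat_cong N A (fib_mat (mconst c * f ^ 2))"
    by blast
qed

lemma four_neq_zero:
  assumes "CHAR('a::field) \<noteq> 2"
  shows "(4 :: 'a poly fract) \<noteq> 0"
proof -
  \<comment> \<open>A divisor of the prime 2 is 1 or 2, so excluding these two values leaves 2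
    invertible.\<close>
  have "CHAR('a) \<noteq> 1"
    using of_nat_CHAR[where 'a = 'a] by auto
  then have "\<not> CHAR('a) dvd 2"
    using assms two_is_prime_nat by (auto simp: prime_nat_iff)
  then have "(2 :: 'a) \<noteq> 0"
    using of_nat_eq_0_iff_char_dvd[of 2, where 'a = 'a] by simp
  then have "(1 + 1 :: 'a poly) \<noteq> 0" by (simp add: one_pCons)
  then have "to_fract (1 + 1 :: 'a poly) \<noteq> 0" by (simp only: to_fract_eq_0_iff not_False_eq_True)
  then have "(2 :: 'a poly fract) \<noteq> 0" unfolding to_fract_add to_fract_1 by simp
  then have "(2 * 2 :: 'a poly fract) \<noteq> 0" unfolding mult_eq_0_iff by simp
  then show ?thesis by simp
qed

text \<open>Polarization. Each of the two squares costs \<open>2 * (m + n + 1) + 3\<close>, and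
  their difference one matrix more.\<close>

lemma fib_approximable_mult:
  fixes f g :: "'a::field poly fract mpoly"
  assumes char: "CHAR('a) \<noteq> 2" and f: "fib_approximable m f" and g: "fib_approximable n g"
  shows "fib_approximable (4 * (m + n) + 11) (f * g)"
proof -
  have "(4 :: 'a poly fract mpoly) * mconst (1 / 4) = mconst (4 * (1 / 4))"
    unfolding mconst_simps(6) by (simp add: mconst_def)
  also have "\<dots> = 1"
    using four_neq_zero[OF char] by (simp del: mconst_simps(6))
  finally have four: "4 * mconst (1 / 4) = (1 :: 'a poly fract mpoly)" .
  have "f * g = (4 * mconst (1 / 4)) * (f * g)"
    by (simp only: four mult_1_left)
  also have "\<dots> = mconst (1 / 4) * (f + g) ^ 2 - mconst (1 / 4) * (f - g) ^ 2"
    by (simp add: power2_eq_square algebra_simps)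
  finally have "f * g = mconst (1 / 4) * (f + g) ^ 2 - mconst (1 / 4) * (f - g) ^ 2" .
  moreover have "fib_approximable ((2 * (m + n + 1) + 3) + (2 * (m + n + 1) + 3) + 1)
      (mconst (1 / 4) * (f + g) ^ 2 - mconst (1 / 4) * (f - g) ^ 2)"
    using f g by (intro fib_approximable_diff fib_approximable_scale fib_approximable_square
        fib_approximable_add)
  ultimately show ?thesis
    by (auto intro: fib_approximable_mono)
qed

section \<open>Balancing formulas\<close>

primrec leaves :: "'k formula \<Rightarrow> nat" where
  "leaves (Var i) = 1"
| "leaves (Const c) = 1"
| "leaves (Add a b) = leaves a + leaves b"
| "leaves (Mult a b) = leaves a + leaves b"

lemma leaves_pos: "leaves \<phi> \<ge> 1"
  by (induction \<phi>) auto

lemma leaves_le_formula_size: "leaves \<phi> \<le> formula_size \<phi>"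
  by (induction \<phi>) auto

text \<open>
  A formula is an affine function of any of its subformulas \<open>\<psi>\<close>: if \<open>\<phi>\<^sub>0\<close> and \<open>\<phi>\<^sub>1\<close> arise by
  replacing \<open>\<psi>\<close> by 0 and 1, it computes \<open>(\<phi>\<^sub>1 - \<phi>\<^sub>0) \<psi> + \<phi>\<^sub>0\<close>. Here \<open>\<psi>\<close> is a minimal subformula with
  more than \<open>h\<close> leaves, and \<open>\<psi>\<^sub>1\<close> and \<open>\<psi>\<^sub>2\<close> are its children.
\<close>

definition splits :: "nat \<Rightarrow> 'k::comm_ring_1 formula \<Rightarrow> bool" where
  "splits h \<phi> \<longleftrightarrow> (\<exists>\<psi>\<^sub>1 \<psi>\<^sub>2 \<phi>\<^sub>0 \<phi>\<^sub>1 p. leaves \<psi>\<^sub>1 \<le> h \<and> leaves \<psi>\<^sub>2 \<le> h \<and> leaves \<psi>\<^sub>1 + leaves \<psi>\<^sub>2 > h \<and>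
    leaves \<phi>\<^sub>0 + (leaves \<psi>\<^sub>1 + leaves \<psi>\<^sub>2) \<le> leaves \<phi> + 1 \<and>
    leaves \<phi>\<^sub>1 + (leaves \<psi>\<^sub>1 + leaves \<psi>\<^sub>2) \<le> leaves \<phi> + 1 \<and>
    (p = formula_poly \<psi>\<^sub>1 + formula_poly \<psi>\<^sub>2 \<or> p = formula_poly \<psi>\<^sub>1 * formula_poly \<psi>\<^sub>2) \<and>
    formula_poly \<phi> = (formula_poly \<phi>\<^sub>1 - formula_poly \<phi>\<^sub>0) * p + formula_poly \<phi>\<^sub>0)"

text \<open>\<open>F\<close> is a formula with one hole, affine in the hole. The offset
  \<open>d\<close> cancels in the difference of the two replaced formulas, so the decomposition of
  \<open>\<psi>\<close> carries over.\<close>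

lemma splits_context:
  assumes "splits h \<psi>"
    and leaves: "\<And>\<chi>. leaves (F \<chi>) = leaves \<chi> + n"
    and affine: "\<And>\<chi>. formula_poly (F \<chi>) = c * formula_poly \<chi> + d"
  shows "splits h (F \<psi>)"
proof -
  obtain \<psi>\<^sub>1 \<psi>\<^sub>2 \<phi>\<^sub>0 \<phi>\<^sub>1 p where *: "leaves \<psi>\<^sub>1 \<le> h \<and> leaves \<psi>\<^sub>2 \<le> h \<and> leaves \<psi>\<^sub>1 + leaves \<psi>\<^sub>2 > h \<and>
      leaves \<phi>\<^sub>0 + (leaves \<psi>\<^sub>1 + leaves \<psi>\<^sub>2) \<le> leaves \<psi> + 1 \<and>
      leaves \<phi>\<^sub>1 + (leaves \<psi>\<^sub>1 + leaves \<psi>\<^sub>2) \<le> leaves \<psi> + 1 \<and>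
      (p = formula_poly \<psi>\<^sub>1 + formula_poly \<psi>\<^sub>2 \<or> p = formula_poly \<psi>\<^sub>1 * formula_poly \<psi>\<^sub>2)"
    and **: "formula_poly \<psi> = (formula_poly \<phi>\<^sub>1 - formula_poly \<phi>\<^sub>0) * p + formula_poly \<phi>\<^sub>0"
    using assms(1) unfolding splits_def by blast
  have "formula_poly (F \<psi>) =
      (formula_poly (F \<phi>\<^sub>1) - formula_poly (F \<phi>\<^sub>0)) * p + formula_poly (F \<phi>\<^sub>0)"
    unfolding affine ** by (simp add: algebra_simps)
  then show ?thesis
    unfolding splits_def leaves using *
    by (intro exI[of _ \<psi>\<^sub>1] exI[of _ \<psi>\<^sub>2] exI[of _ "F \<phi>\<^sub>0"] exI[of _ "F \<phi>\<^sub>1"] exI[of _ p])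
      (simp add: leaves)
qed

text \<open>Here the chosen subformula is all of \<open>\<phi>\<close>, and the two replacements are
  the constants 0 and 1. Their single leaf accounts for the summand 1 in the leaf bounds of
  \<open>splits\<close>.\<close>

lemma splits_children:
  assumes "leaves \<psi>\<^sub>1 \<le> h" "leaves \<psi>\<^sub>2 \<le> h" "leaves \<psi>\<^sub>1 + leaves \<psi>\<^sub>2 > h"
    and "leaves \<phi> = leaves \<psi>\<^sub>1 + leaves \<psi>\<^sub>2"
    and "formula_poly \<phi> = formula_poly \<psi>\<^sub>1 + formula_poly \<psi>\<^sub>2 \<or>
      formula_poly \<phi> = formula_poly \<psi>\<^sub>1 * formula_poly \<psi>\<^sub>2"
  shows "splits h \<phi>"
  unfolding splits_def using assms
  by (intro exI[of _ \<psi>\<^sub>1] exI[of _ \<psi>\<^sub>2] exI[of _ "Const 0"] exI[of _ "Const 1"]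
      exI[of _ "formula_poly \<phi>"]) simp

text \<open>Descend into a child with more than \<open>h\<close> leaves as long as there is
  one.\<close>

lemma formula_split: "leaves \<phi> > h \<Longrightarrow> h \<ge> 1 \<Longrightarrow> splits h \<phi>"
proof (induction \<phi>)
  case (Add a b)
  consider "leaves a > h" | "leaves b > h" | "leaves a \<le> h" "leaves b \<le> h" by linarith
  then show ?case
  proof cases
    case 1
    then show ?thesis
      using splits_context[of h a "\<lambda>\<chi>. Add \<chi> b" "leaves b" 1 "formula_poly b"] Add by simp
  next
    case 2
    then show ?thesis
      using splits_context[of h b "\<lambda>\<chi>. Add a \<chi>" "leaves a" 1 "formula_poly a"] Add by simp
  next
    case 3
    then show ?thesis using Add.prems by (intro splits_children[of a h b]) auto
  qed
next
  case (Mult a b)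
  consider "leaves a > h" | "leaves b > h" | "leaves a \<le> h" "leaves b \<le> h" by linarith
  then show ?case
  proof cases
    case 1
    then show ?thesis
      using splits_context[of h a "\<lambda>\<chi>. Mult \<chi> b" "leaves b" "formula_poly b" 0] Mult
      by (simp add: mult.commute)
  next
    case 2
    then show ?thesis
      using splits_context[of h b "\<lambda>\<chi>. Mult a \<chi>" "leaves a" "formula_poly a" 0] Mult by simp
  next
    case 3
    then show ?thesis using Mult.prems by (intro splits_children[of a h b]) auto
  qed
qed simp_all

text \<open>With \<open>t\<close> matrices for each of the four parts, the reassembled formula needs
  \<open>41 * t + 60\<close> matrices, at most \<open>101 * t\<close>.\<close>

lemma fib_approximable_formula:
  fixes \<phi> :: "'a::field poly fract formula"
  assumes char: "CHAR('a) \<noteq> 2" and "leaves \<phi> \<le> 2 ^ k"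
  shows "fib_approximable (101 ^ k) (formula_poly \<phi>)"
  using assms(2)
proof (induction k arbitrary: \<phi>)
  case 0
  then show ?case
  proof (cases \<phi>)
    case (Add a b)
    then show ?thesis using 0 leaves_pos[of a] leaves_pos[of b] by simp
  next
    case (Mult a b)
    then show ?thesis using 0 leaves_pos[of a] leaves_pos[of b] by simp
  qed (use fib_approximable_mvar fib_approximable_mconst in auto)
next
  case (Suc k)
  define t :: nat where "t = 101 ^ k"
  have "t \<ge> 1" by (simp add: t_def)
  show ?case
  proof (cases "leaves \<phi> \<le> 2 ^ k")
    case True
    then have "fib_approximable t (formula_poly \<phi>)"
      unfolding t_def by (rule Suc.IH)
    then show ?thesis
      by (rule fib_approximable_mono) (simp add: t_def)
  next
    case False
    then obtain \<psi>\<^sub>1 \<psi>\<^sub>2 \<phi>\<^sub>0 \<phi>\<^sub>1 p where *: "leaves \<psi>\<^sub>1 \<le> 2 ^ k \<and> leaves \<psi>\<^sub>2 \<le> 2 ^ k \<and>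
      leaves \<psi>\<^sub>1 + leaves \<psi>\<^sub>2 > 2 ^ k \<and>
      leaves \<phi>\<^sub>0 + (leaves \<psi>\<^sub>1 + leaves \<psi>\<^sub>2) \<le> leaves \<phi> + 1 \<and>
      leaves \<phi>\<^sub>1 + (leaves \<psi>\<^sub>1 + leaves \<psi>\<^sub>2) \<le> leaves \<phi> + 1 \<and>
      (p = formula_poly \<psi>\<^sub>1 + formula_poly \<psi>\<^sub>2 \<or> p = formula_poly \<psi>\<^sub>1 * formula_poly \<psi>\<^sub>2) \<and>
      formula_poly \<phi> = (formula_poly \<phi>\<^sub>1 - formula_poly \<phi>\<^sub>0) * p + formula_poly \<phi>\<^sub>0"
      using formula_split[of "2 ^ k" \<phi>] unfolding splits_def by fastforce
    \<comment> \<open>The removed subformula has at least \<open>2 ^ k + 1\<close> leaves and is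
      replaced by one leaf, out of at most \<open>2 ^ Suc k\<close> in total.\<close>
    then have "leaves \<phi>\<^sub>0 \<le> 2 ^ k" "leaves \<phi>\<^sub>1 \<le> 2 ^ k"
      using Suc.prems by auto
    then have IH: "fib_approximable t (formula_poly \<psi>\<^sub>1)" "fib_approximable t (formula_poly \<psi>\<^sub>2)"
      "fib_approximable t (formula_poly \<phi>\<^sub>0)" "fib_approximable t (formula_poly \<phi>\<^sub>1)"
      using * unfolding t_def by (auto intro: Suc.IH)
    have "fib_approximable (4 * (t + t) + 11) p"
      using * fib_approximable_mult[OF char IH(1,2)]
        fib_approximable_mono[OF fib_approximable_add[OF IH(1,2)], of "4 * (t + t) + 11"] by auto
    then have "fib_approximable (4 * (t + t + 1 + (4 * (t + t) + 11)) + 11 + t + 1)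
        ((formula_poly \<phi>\<^sub>1 - formula_poly \<phi>\<^sub>0) * p + formula_poly \<phi>\<^sub>0)"
      by (intro fib_approximable_add fib_approximable_mult[OF char] fib_approximable_diff IH)
    then have "fib_approximable (4 * (t + t + 1 + (4 * (t + t) + 11)) + 11 + t + 1) (formula_poly \<phi>)"
      using * by simp
    then show ?thesis
      by (rule fib_approximable_mono) (use \<open>t \<ge> 1\<close> in \<open>simp flip: t_def\<close>)
  qed
qed

section \<open>Upper bound on the border Fibonacci complexity\<close>

lemma INF_enat_le_iff: "(INF x\<in>A. enat (f x)) \<le> enat n \<longleftrightarrow> (\<exists>x\<in>A. f x \<le> n)"
proof
  assume le: "(INF x\<in>A. enat (f x)) \<le> enat n"
  show "\<exists>x\<in>A. f x \<le> n"
  proof (rule ccontr)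
    assume "\<not> (\<exists>x\<in>A. f x \<le> n)"
    then have "enat (Suc n) \<le> (INF x\<in>A. enat (f x))"
      by (intro INF_greatest) (auto simp: not_le)
    from this le have "enat (Suc n) \<le> enat n" by (rule order_trans)
    then show False by simp
  qed
next
  assume "\<exists>x\<in>A. f x \<le> n"
  then show "(INF x\<in>A. enat (f x)) \<le> enat n"
    by (auto intro: INF_lower2)
qed

section \<open>Polynomials in \<open>eps\<close> among the rational functions\<close>

lemma lookup_embed: "Poly_Mapping.lookup (embed f) t = to_fract [:Poly_Mapping.lookup f t:]"
  by (simp add: embed_def lookup_map_zero)

lemma lookup_embed_eps: "Poly_Mapping.lookup (embed_eps f) t = to_fract (Poly_Mapping.lookup f t)"
  by (simp add: embed_eps_def lookup_map_zero)

lemma embed_eps_add: "embed_eps (f + g) = embed_eps f + embed_eps g"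
  by (rule poly_mapping_eqI) (simp add: lookup_embed_eps lookup_add)

text \<open>Reduces the existence of a polynomial error term to a membership statement about
  coefficients.\<close>

lemma range_embed_eps: "range embed_eps = coeffs_in (range to_fract)"
proof (intro set_eqI iffI)
  fix p :: "'a poly fract mpoly" assume p: "p \<in> coeffs_in (range to_fract)"
  have inv: "inv to_fract (to_fract c) = c" for c :: "'a poly"
    by (intro inv_f_f injI) simp
  have "p = embed_eps (Poly_Mapping.map (inv to_fract) p)"
  proof (rule poly_mapping_eqI)
    fix t
    have "Poly_Mapping.lookup p t \<in> range to_fract"
      using p by (simp add: coeffs_in_def)
    moreover have "inv to_fract 0 = (0 :: 'a poly)"
      using inv[of 0] by simp
    ultimately show "Poly_Mapping.lookup p t =
        Poly_Mapping.lookup (embed_eps (Poly_Mapping.map (inv to_fract) p)) t"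
      by (auto simp: lookup_embed_eps lookup_map_zero inv)
  qed
  then show "p \<in> range embed_eps" by blast
qed (auto simp: coeffs_in_def lookup_embed_eps)

lemma subring_set_range_to_fract: "subring_set (range to_fract)"
  unfolding subring_set_def by (auto simp flip: to_fract_1 to_fract_diff to_fract_mult)

lemma embed_mem_coeffs_in: "embed f \<in> coeffs_in (range to_fract)"
  by (auto simp: coeffs_in_def lookup_embed)

lemma sum_eps_embed_eq:
  "\<exists>h. (\<Sum>i = 1..e. mconst (eps ^ i) * embed (fs i)) = mconst eps * embed_eps h"
proof -
  have mem: "mconst (eps ^ j) * embed (fs i) \<in> coeffs_in (range to_fract)" for i j
    unfolding eps_power
    by (intro mconst_mult_mem_coeffs_in subring_set_range_to_fract embed_mem_coeffs_in) simp
  have "(\<Sum>i = 1..e. mconst (eps ^ (i - 1)) * embed (fs i)) \<in> coeffs_in (range to_fract)"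
    by (intro sum_mem_subring_set subring_set_coeffs_in subring_set_range_to_fract mem)
  then obtain h where h: "(\<Sum>i = 1..e. mconst (eps ^ (i - 1)) * embed (fs i)) = embed_eps h"
    unfolding range_embed_eps [symmetric] by blast
  have "mconst (eps ^ i) * embed (fs i) = mconst eps * (mconst (eps ^ (i - 1)) * embed (fs i))"
    if "i \<in> {1..e}" for i
    using that by (cases i) (auto simp: mult.assoc)
  then have "(\<Sum>i = 1..e. mconst (eps ^ i) * embed (fs i)) = mconst eps * embed_eps h"
    unfolding h [symmetric] sum_distrib_left by (rule sum.cong[OF refl])
  then show ?thesis by blast
qed

lemma fib_prod_entries_mem:
  assumes "subring_set C" "set xs \<subseteq> C"
  shows "set_mat2 (fib_prod xs) \<subseteq> C"
  using assms(2)
proof (induction xs)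
  case Nil
  then show ?case
    using subring_setD[OF assms(1)] by (simp add: one_mat2_def)
next
  case (Cons x xs)
  then show ?case
    using subring_setD[OF assms(1)] by (cases "fib_prod xs") (auto simp: fib_mat_def)
qed

text \<open>Precision 1 suffices. The error is \<open>eps * r\<close> with \<open>r\<close> regular
  at 0; all other quantities are Laurent polynomials in \<open>eps\<close>, hence so is
  \<open>r\<close>, and it is a polynomial.\<close>

lemma border_fib_complexity_le:
  assumes "fib_approximable m (embed f + mconst eps * embed_eps h)"
  shows "border_fib_complexity f \<le> enat m"
proof -
  define g where "g = embed f + mconst eps * embed_eps h"
  have "fib_mat g \<in> fib_closure m"
    using assms unfolding fib_approximable_def g_def by (metis mconst_simps(2) mult_1_left)
  then obtain xs where xs: "length xs \<le> m" "set xs \<subseteq> affine_forms \<inter> coeffs_in laurent"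
      "mat_cong 1 (fib_prod xs) (fib_mat g)"
    unfolding fib_closure_def by blast
  then have "eps_cong 1 (e11 (fib_prod xs)) g"
    by (cases "fib_prod xs") (simp add: fib_mat_def)
  then obtain r where r: "r \<in> coeffs_in local_ring" "e11 (fib_prod xs) - g = mconst eps * r"
    unfolding eps_cong_def by auto
  note laurent = subring_setD[OF subring_set_coeffs_in[OF subring_set_laurent]]
  have "e11 (fib_prod xs) \<in> coeffs_in laurent"
    using fib_prod_entries_mem[OF subring_set_coeffs_in[OF subring_set_laurent], of xs] xs(2)
      mat2.set_sel(1) by blast
  moreover have "g \<in> coeffs_in laurent"
  proof -
    have "embed f \<in> coeffs_in laurent" "embed_eps h \<in> coeffs_in laurent"
      by (auto simp: coeffs_in_def lookup_embed lookup_embed_eps to_fract_mem_laurent)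
    moreover have "eps \<in> laurent" by (simp add: eps_def to_fract_mem_laurent)
    ultimately show ?thesis
      unfolding g_def by (intro laurent(5) mconst_mult_mem_coeffs_in subring_set_laurent)
  qed
  \<comment> \<open>Dividing by \<open>eps\<close> stays within the Laurent polynomials, which gives
    the second property of \<open>r\<close>.\<close>
  moreover have "to_fract 1 / eps ^ 1 \<in> laurent"
    unfolding laurent_def by blast
  ultimately have "mconst (to_fract 1 / eps ^ 1) * (e11 (fib_prod xs) - g) \<in> coeffs_in laurent"
    by (intro mconst_mult_mem_coeffs_in subring_set_laurent laurent(3))
  also have "mconst (to_fract 1 / eps ^ 1) * (e11 (fib_prod xs) - g) = mconst (1 / eps * eps) * r"
    unfolding r(2) mconst_simps(6) by (simp add: mult.assoc)
  finally have "r \<in> coeffs_in laurent" by simp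
  then have "r \<in> coeffs_in (range to_fract)"
    using r(1) laurent_Int_local_ring unfolding coeffs_in_def by blast
  then obtain h' where h': "r = embed_eps h'"
    unfolding range_embed_eps [symmetric] by blast
  have "e11 (fib_prod xs) = embed f + mconst eps * embed_eps (h + h')"
    using r(2) by (simp add: g_def h' embed_eps_add algebra_simps)
  then have "fib_poly (length xs) (\<lambda>i. rev xs ! (i - 1)) = embed f + mconst eps * embed_eps (h + h')"
    by (simp only: fib_prod_eq_fib_poly)
  moreover have "rev xs ! (i - 1) \<in> affine_forms" if "i \<in> {1..length xs}" for i
  proof -
    have "rev xs ! (i - 1) \<in> set (rev xs)"
      using that by (intro nth_mem) auto
    then show ?thesis using xs(2) by auto
  qed
  ultimately have "border_fib_computes (length xs) f"
    unfolding border_fib_computes_def by (intro exI[of _ "\<lambda>i. rev xs ! (i - 1)"]) auto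
  then show ?thesis
    unfolding border_fib_complexity_def INF_enat_le_iff using xs(1) by blast
qed

lemma power_two_between: "\<exists>k. m \<le> 2 ^ k \<and> 2 ^ k \<le> 2 * m + (1 :: nat)"
proof (induction m)
  case 0
  show ?case by (rule exI[of _ 0]) simp
next
  case (Suc m)
  then obtain k where k: "m \<le> 2 ^ k" "2 ^ k \<le> 2 * m + 1" by blast
  then show ?case
  proof (cases "m = 2 ^ k")
    case True
    then show ?thesis by (intro exI[of _ "Suc k"]) (simp add: Suc_le_eq)
  next
    case False
    then show ?thesis using k by (intro exI[of _ k]) auto
  qed
qed

text \<open>Rounding \<open>s\<close> up to a power of two makes \<open>k\<close> logarithmic in
  \<open>s\<close>, so \<open>101 ^ k\<close> is polynomially bounded. The exponent 7 comes from
  \<open>101 \<le> 2 ^ 7\<close>.\<close>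

lemma border_fib_complexity_le_formula_complexity:
  fixes f :: "'a::field mpoly"
  assumes "CHAR('a) \<noteq> 2"
    and "formula_complexity (embed f + (\<Sum>i = 1..e. mconst (eps ^ i) * embed (fs i))) \<le> enat s"
  shows "border_fib_complexity f \<le> enat ((2 * s + 1) ^ 7)"
proof -
  obtain \<phi> where \<phi>: "formula_poly \<phi> = embed f + (\<Sum>i = 1..e. mconst (eps ^ i) * embed (fs i))"
    "formula_size \<phi> \<le> s"
    using assms(2) unfolding formula_complexity_def INF_enat_le_iff by blast
  obtain h where h: "(\<Sum>i = 1..e. mconst (eps ^ i) * embed (fs i)) = mconst eps * embed_eps h"
    using sum_eps_embed_eq by blast
  obtain k where k: "s \<le> 2 ^ k" "2 ^ k \<le> 2 * s + 1"
    using power_two_between by blast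
  have "leaves \<phi> \<le> 2 ^ k"
    using leaves_le_formula_size[of \<phi>] \<phi>(2) k(1) by linarith
  then have "fib_approximable (101 ^ k) (embed f + mconst eps * embed_eps h)"
    using fib_approximable_formula[OF assms(1)] \<phi>(1) h by metis
  then have "border_fib_complexity f \<le> enat (101 ^ k)"
    by (rule border_fib_complexity_le)
  also have "(101 :: nat) ^ k \<le> (2 ^ 7) ^ k"
    by (intro power_mono) auto
  also have "\<dots> = (2 ^ k) ^ 7"
    by (simp only: power_mult [symmetric] mult.commute)
  also have "\<dots> \<le> (2 * s + 1) ^ 7"
    using k(2) by (intro power_mono) auto
  finally show ?thesis by simp
qed

section \<open>Formulas for continuants of affine forms\<close>

lift_definition restrict_vars :: "nat set \<Rightarrow> 'k::zero mpoly \<Rightarrow> 'k mpoly" is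
  "\<lambda>W p t. if Poly_Mapping.keys t \<subseteq> W then p t else 0"
  by (rule finite_subset) auto

lemma lookup_restrict_vars:
  "Poly_Mapping.lookup (restrict_vars W p) t =
    (if Poly_Mapping.keys t \<subseteq> W then Poly_Mapping.lookup p t else 0)"
  by (simp add: restrict_vars.rep_eq)

lemma keys_restrict_vars:
  "Poly_Mapping.keys (restrict_vars W p) = {t \<in> Poly_Mapping.keys p. Poly_Mapping.keys t \<subseteq> W}"
  by (auto simp: in_keys_iff[of _ p] in_keys_iff[of _ "restrict_vars W p"] lookup_restrict_vars
      split: if_splits)

lemma restrict_vars_add: "restrict_vars W (p + q) = restrict_vars W p + restrict_vars W q"
  by (rule poly_mapping_eqI) (simp add: lookup_restrict_vars lookup_add)

lemma restrict_vars_0 [simp]: "restrict_vars W 0 = 0"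
  by (rule poly_mapping_eqI) (simp add: lookup_restrict_vars)

lemma restrict_vars_sum: "restrict_vars W (\<Sum>i\<in>A. f i) = (\<Sum>i\<in>A. restrict_vars W (f i))"
  by (induction A rule: infinite_finite_induct) (simp_all add: restrict_vars_add)

lemma restrict_vars_mconst [simp]: "restrict_vars W (mconst c) = mconst c"
  by (rule poly_mapping_eqI) (auto simp: lookup_restrict_vars mconst_def lookup_single when_def)

lemma restrict_vars_1 [simp]: "restrict_vars W (1 :: 'k::comm_ring_1 mpoly) = 1"
  using restrict_vars_mconst[of W "1 :: 'k"] by simp

lemma restrict_vars_mvar: "restrict_vars W (mvar i) = (if i \<in> W then mvar i else 0)"
  by (rule poly_mapping_eqI) (auto simp: lookup_restrict_vars mvar_def lookup_single when_def)

lemma mvars_restrict_vars: "mvars (restrict_vars W p) \<subseteq> W"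
  by (auto simp: mvars_def keys_restrict_vars)

lemma restrict_vars_id: "mvars p \<subseteq> W \<Longrightarrow> restrict_vars W p = p"
  by (rule poly_mapping_eqI) (auto simp: lookup_restrict_vars mvars_def UN_subset_iff in_keys_iff[of _ p])

lemma keys_add_monomial:
  "Poly_Mapping.keys (s + t :: nat \<Rightarrow>\<^sub>0 nat) = Poly_Mapping.keys s \<union> Poly_Mapping.keys t"
  by (auto simp: in_keys_iff lookup_add)

lemma restrict_vars_eq_0_iff:
  "restrict_vars W p = 0 \<longleftrightarrow> (\<forall>t\<in>Poly_Mapping.keys p. \<not> Poly_Mapping.keys t \<subseteq> W)"
  unfolding keys_eq_empty [symmetric] keys_restrict_vars by auto

text \<open>
  The polynomials in the variables \<open>W\<close> form a complement of the ideal generated by the other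
  variables.
\<close>

lemma restrict_vars_mult:
  fixes p q :: "'k::comm_ring_1 mpoly"
  shows "restrict_vars W (p * q) = restrict_vars W p * restrict_vars W q"
proof -
  have ideal: "restrict_vars W (x * y) = 0" if "restrict_vars W y = 0" for x y :: "'k mpoly"
    unfolding restrict_vars_eq_0_iff
  proof
    fix t assume "t \<in> Poly_Mapping.keys (x * y)"
    then obtain u v where "t = u + v" "v \<in> Poly_Mapping.keys y"
      using keys_mult[of x y] by blast
    then show "\<not> Poly_Mapping.keys t \<subseteq> W"
      using that unfolding restrict_vars_eq_0_iff by (simp add: keys_add_monomial)
  qed
  define p' q' where "p' = p - restrict_vars W p" and "q' = q - restrict_vars W q"
  have p': "p = restrict_vars W p + p'" and q': "q = restrict_vars W q + q'"
    by (simp_all add: p'_def q'_def)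
  have "restrict_vars W p' = 0" "restrict_vars W q' = 0"
    by (rule poly_mapping_eqI, simp add: p'_def q'_def lookup_restrict_vars lookup_minus)+
  then have "restrict_vars W (p * q') = 0" "restrict_vars W (restrict_vars W q * p') = 0"
    using ideal by auto
  moreover have "p * q = restrict_vars W p * restrict_vars W q + restrict_vars W q * p' + p * q'"
    by (subst (1) q', simp only: distrib_left, subst (1) p') (simp add: algebra_simps)
  moreover have "mvars (restrict_vars W p * restrict_vars W q) \<subseteq> W"
    using keys_mult[of "restrict_vars W p" "restrict_vars W q"]
    unfolding mvars_def keys_restrict_vars by (fastforce simp: keys_add_monomial)
  ultimately show ?thesis
    by (simp add: restrict_vars_add restrict_vars_id)
qed

lemma restrict_vars_fib_poly:
  "restrict_vars W (fib_poly m x) = fib_poly m (\<lambda>i. restrict_vars W (x i))"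
  by (induction m x rule: fib_poly.induct) (simp_all add: restrict_vars_add restrict_vars_mult)

lemma restrict_vars_embed: "restrict_vars W (embed f) = embed (restrict_vars W f)"
  by (rule poly_mapping_eqI) (simp add: lookup_restrict_vars lookup_embed)

lemma restrict_vars_embed_eps: "restrict_vars W (embed_eps f) = embed_eps (restrict_vars W f)"
  by (rule poly_mapping_eqI) (simp add: lookup_restrict_vars lookup_embed_eps)

text \<open>Each variable in \<open>W\<close> costs four vertices, a sum, a product, a constant and
  the variable; the constant term costs one. Variables outside \<open>W\<close>, of which there may
  be far more, cost nothing.\<close>

lemma restrict_vars_affine_form_formula:
  assumes "l \<in> affine_forms" "finite W"
  shows "\<exists>\<phi>. formula_poly \<phi> = restrict_vars W l \<and> formula_size \<phi> \<le> 4 * card W + 1"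
proof -
  obtain c a V where V: "finite V" "l = mconst c + (\<Sum>i\<in>V. mconst (a i) * mvar i)"
    using assms(1) unfolding affine_forms_def by blast
  have "\<exists>\<phi>. formula_poly \<phi> = mconst c + (\<Sum>i\<in>U. mconst (a i) * mvar i) \<and>
      formula_size \<phi> \<le> 4 * card U + 1" if "finite U" for U
    using that
  proof induction
    case empty
    show ?case by (intro exI[of _ "Const c"]) simp
  next
    case (insert i U)
    then obtain \<phi> where "formula_poly \<phi> = mconst c + (\<Sum>i\<in>U. mconst (a i) * mvar i)"
      "formula_size \<phi> \<le> 4 * card U + 1" by blast
    then show ?case
      using insert.hyps by (intro exI[of _ "Add (Mult (Const (a i)) (Var i)) \<phi>"]) simp
  qed
  then obtain \<phi> where \<phi>: "formula_poly \<phi> = mconst c + (\<Sum>i\<in>V \<inter> W. mconst (a i) * mvar i)"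
    "formula_size \<phi> \<le> 4 * card (V \<inter> W) + 1"
    using V(1) by blast
  have "restrict_vars W l = mconst c + (\<Sum>i\<in>V. if i \<in> W then mconst (a i) * mvar i else 0)"
    unfolding V(2) restrict_vars_add restrict_vars_sum restrict_vars_mult restrict_vars_mvar
    by (auto intro!: sum.cong)
  then have "formula_poly \<phi> = restrict_vars W l"
    using V(1) by (simp add: \<phi>(1) sum.inter_restrict)
  moreover have "card (V \<inter> W) \<le> card W"
    using assms(2) by (intro card_mono) auto
  ultimately show ?thesis
    using \<phi>(2) by (intro exI[of _ \<phi>]) auto
qed

text \<open>
  Splitting the product in the middle gives a formula of polynomial size. The recursion for the
  \<open>F\<^sub>m\<close> would lead to one of exponential size.
\<close>

lemma fib_prod_formula:
  assumes "\<And>x. x \<in> set xs \<Longrightarrow> \<exists>\<phi>. formula_poly \<phi> = x \<and> formula_size \<phi> \<le> s"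
    and "s \<ge> 1" "length xs \<le> 2 ^ k" "p \<in> set_mat2 (fib_prod xs)"
  shows "\<exists>\<phi>. formula_poly \<phi> = p \<and> formula_size \<phi> + 1 \<le> 4 ^ k * (s + 1)"
  using assms(1,3,4)
proof (induction k arbitrary: xs p)
  case 0
  have const: "\<exists>\<phi>. formula_poly \<phi> = q \<and> formula_size \<phi> \<le> s" if "q = 0 \<or> q = 1" for q
    using that assms(2) by (auto intro: exI[of _ "Const 0"] exI[of _ "Const 1"])
  have "\<exists>\<phi>. formula_poly \<phi> = p \<and> formula_size \<phi> \<le> s"
  proof (cases xs)
    case Nil
    then show ?thesis using 0 const by (auto simp: one_mat2_def)
  next
    case (Cons x ys)
    then have "fib_prod xs = fib_mat x" using 0 by simp
    then show ?thesis using 0 const Cons by (auto simp: fib_mat_def)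
  qed
  then show ?case by auto
next
  case (Suc k)
  define ys zs where "ys = take (2 ^ k) xs" and "zs = drop (2 ^ k) xs"
  have "xs = ys @ zs" by (simp add: ys_def zs_def)
  have len: "length ys \<le> 2 ^ k" "length zs \<le> 2 ^ k"
    using Suc.prems(2) by (auto simp: ys_def zs_def)
  have set: "set ys \<subseteq> set xs" "set zs \<subseteq> set xs"
    by (auto simp: \<open>xs = ys @ zs\<close>)
  have IHy: "\<exists>\<phi>. formula_poly \<phi> = q \<and> formula_size \<phi> + 1 \<le> 4 ^ k * (s + 1)"
    if "q \<in> set_mat2 (fib_prod ys)" for q
    using Suc.IH[OF Suc.prems(1) len(1) that] set(1) by blast
  have IHz: "\<exists>\<phi>. formula_poly \<phi> = q \<and> formula_size \<phi> + 1 \<le> 4 ^ k * (s + 1)"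
    if "q \<in> set_mat2 (fib_prod zs)" for q
    using Suc.IH[OF Suc.prems(1) len(2) that] set(2) by blast
  have "p \<in> set_mat2 (fib_prod ys * fib_prod zs)"
    using Suc.prems(3) by (simp add: \<open>xs = ys @ zs\<close>)
  then obtain a b c d where "a \<in> set_mat2 (fib_prod ys)" "b \<in> set_mat2 (fib_prod ys)"
    "c \<in> set_mat2 (fib_prod zs)" "d \<in> set_mat2 (fib_prod zs)" and p: "p = a * c + b * d"
    by (cases "fib_prod ys"; cases "fib_prod zs") auto
  then obtain \<alpha> \<beta> \<gamma> \<delta> where
    "formula_poly \<alpha> = a" "formula_size \<alpha> + 1 \<le> 4 ^ k * (s + 1)"
    "formula_poly \<beta> = b" "formula_size \<beta> + 1 \<le> 4 ^ k * (s + 1)"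
    "formula_poly \<gamma> = c" "formula_size \<gamma> + 1 \<le> 4 ^ k * (s + 1)"
    "formula_poly \<delta> = d" "formula_size \<delta> + 1 \<le> 4 ^ k * (s + 1)"
    using IHy IHz by metis
  \<comment> \<open>The new size plus 1 is the sum of the four old sizes, each plus 1. This is why
    the bound is stated for \<open>formula_size \<phi> + 1\<close>.\<close>
  then show ?case
    unfolding p by (intro exI[of _ "Add (Mult \<alpha> \<gamma>) (Mult \<beta> \<delta>)"]) simp
qed

text \<open>Sorts by powers of \<open>eps\<close>; the sum of the degrees of all coefficients bounds
  each of them.\<close>

lemma embed_eps_eq_sum:
  "\<exists>d fs. embed_eps h = (\<Sum>i\<le>d. mconst (eps ^ i) * embed (fs i))"
proof -
  define d where "d = (\<Sum>t\<in>Poly_Mapping.keys h. degree (Poly_Mapping.lookup h t))"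
  define fs where "fs i = Poly_Mapping.map (\<lambda>c. coeff c i) h" for i
  have "embed_eps h = (\<Sum>i\<le>d. mconst (eps ^ i) * embed (fs i))"
  proof (rule poly_mapping_eqI)
    fix t
    define c where "c = Poly_Mapping.lookup h t"
    have "degree c \<le> d"
    proof (cases "t \<in> Poly_Mapping.keys h")
      case True
      then show ?thesis unfolding c_def d_def by (intro member_le_sum) auto
    next
      case False
      then show ?thesis by (simp add: c_def in_keys_iff)
    qed
    then have "c = (\<Sum>i\<le>d. monom (coeff c i) i)"
      by (rule poly_as_sum_of_monoms' [symmetric])
    also have "\<dots> = (\<Sum>i\<le>d. [:0, 1:] ^ i * [:coeff c i:])"
      by (simp add: monom_altdef)
    finally have "to_fract c = to_fract (\<Sum>i\<le>d. [:0, 1:] ^ i * [:coeff c i:])"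
      by (rule arg_cong)
    then show "Poly_Mapping.lookup (embed_eps h) t =
        Poly_Mapping.lookup (\<Sum>i\<le>d. mconst (eps ^ i) * embed (fs i)) t"
      by (simp only: lookup_sum lookup_mconst_mult lookup_embed lookup_embed_eps to_fract_sum
          to_fract_mult eps_power c_def [symmetric])
        (simp add: fs_def lookup_map_zero c_def)
  qed
  then show ?thesis by blast
qed

text \<open>Setting the variables outside \<open>mvars f\<close> to 0 fixes \<open>f\<close>, keeps
  the forms affine and the error divisible by \<open>eps\<close>, and leaves only variables of
  \<open>f\<close> in the forms and the error.\<close>

lemma formula_complexity_le_border_fib_complexity:
  fixes f :: "'a::field mpoly"
  assumes "border_fib_complexity f \<le> enat m"
  shows "\<exists>fs e. mvars (embed f + (\<Sum>i = 1..e. mconst (eps ^ i) * embed (fs i))) \<subseteq> mvars f \<and>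
    formula_complexity (embed f + (\<Sum>i = 1..e. mconst (eps ^ i) * embed (fs i)))
      \<le> enat ((2 * m + 1) ^ 2 * (4 * card (mvars f) + 2))"
proof -
  define W where "W = mvars f"
  obtain n where n: "n \<le> m" "border_fib_computes n f"
    using assms unfolding border_fib_complexity_def INF_enat_le_iff by blast
  then obtain l h where l: "\<forall>i\<in>{1..n}. l i \<in> affine_forms"
    and h: "fib_poly n l = embed f + mconst eps * embed_eps h"
    unfolding border_fib_computes_def by blast
  define g where "g = embed f + mconst eps * embed_eps (restrict_vars W h)"
  have "restrict_vars W f = f"
    by (rule restrict_vars_id) (simp add: W_def)
  then have g: "restrict_vars W (fib_poly n l) = g"
    unfolding h g_def by (simp add: restrict_vars_add restrict_vars_mult restrict_vars_embed restrict_vars_embed_eps)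
  obtain d fs where fs: "embed_eps (restrict_vars W h) = (\<Sum>i\<le>d. mconst (eps ^ i) * embed (fs i))"
    using embed_eps_eq_sum by blast
  \<comment> \<open>The factor \<open>eps\<close> raises every exponent by one, so the sum starts at
    1 as in \<open>VPe_closure\<close>.\<close>
  have "mconst eps * embed_eps (restrict_vars W h) =
      (\<Sum>i\<le>d. mconst (eps ^ Suc i) * embed (fs (Suc i - 1)))"
    unfolding fs sum_distrib_left by (simp add: mult.assoc)
  also have "\<dots> = (\<Sum>i = 1..Suc d. mconst (eps ^ i) * embed (fs (i - 1)))"
    unfolding atMost_atLeast0 One_nat_def
    by (rule sum.shift_bounds_cl_Suc_ivl [symmetric])
  finally have g_sum: "g = embed f + (\<Sum>i = 1..Suc d. mconst (eps ^ i) * embed (fs (i - 1)))"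
    by (simp only: g_def)
  have "mvars g \<subseteq> W"
    unfolding g [symmetric] by (rule mvars_restrict_vars)
  define xs where "xs = map (\<lambda>i. restrict_vars W (l i)) (rev [1..<Suc n])"
  obtain k where k: "m \<le> 2 ^ k" "2 ^ k \<le> 2 * m + 1"
    using power_two_between by blast
  have "g = e11 (fib_prod xs)"
    unfolding g [symmetric] restrict_vars_fib_poly xs_def by (rule fib_poly_eq_fib_prod)
  then have "g \<in> set_mat2 (fib_prod xs)"
    using mat2.set_sel(1) by simp
  moreover have "length xs \<le> 2 ^ k"
    using n(1) k(1) by (simp add: xs_def)
  moreover have "\<exists>\<phi>. formula_poly \<phi> = x \<and> formula_size \<phi> \<le> 4 * card W + 1" if "x \<in> set xs" for x
  proof -
    obtain i where "1 \<le> i" "i < Suc n" "x = restrict_vars W (l i)"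
      using \<open>x \<in> set xs\<close> by (auto simp: xs_def simp del: upt_Suc)
    then show ?thesis
      using l restrict_vars_affine_form_formula[of "l i" W] by (simp add: W_def)
  qed
  moreover have "4 * card W + 1 \<ge> 1" by simp
  ultimately obtain \<phi> where \<phi>: "formula_poly \<phi> = g"
      "formula_size \<phi> + 1 \<le> 4 ^ k * (4 * card W + 1 + 1)"
    using fib_prod_formula[of xs "4 * card W + 1" k g] by meson
  have "(4 :: nat) ^ k = (2 ^ 2) ^ k" by simp
  also have "\<dots> = (2 ^ k) ^ 2"
    by (simp only: power_mult [symmetric] mult.commute)
  also have "\<dots> \<le> (2 * m + 1) ^ 2"
    using k(2) by (intro power_mono) auto
  finally have "4 ^ k * (4 * card W + 1 + 1) \<le> (2 * m + 1) ^ 2 * (4 * card W + 2)"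
    by (intro mult_mono) auto
  then have "formula_complexity g \<le> enat ((2 * m + 1) ^ 2 * (4 * card W + 2))"
    unfolding formula_complexity_def INF_enat_le_iff using \<phi> by (intro bexI[of _ \<phi>]) auto
  then show ?thesis
    using \<open>mvars g \<subseteq> W\<close> unfolding g_sum W_def
    by (intro exI[of _ "\<lambda>i. fs (i - 1)"] exI[of _ "Suc d"] conjI)
qed

section \<open>The two inclusions\<close>

theorem theorem3p11:
  assumes "CHAR('a::field) \<noteq> 2"
  shows "(VPe_closure :: (nat \<Rightarrow> 'a mpoly) set) =
    {f \<in> families. poly_bounded (\<lambda>n. border_fib_complexity (f n))}"
proof (intro set_eqI iffI)
  fix f :: "nat \<Rightarrow> 'a mpoly"
  assume "f \<in> VPe_closure"
  then obtain fs e q where "f \<in> families" and q: "\<And>n. formula_complexity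
      (embed (f n) + (\<Sum>i = 1..e n. mconst (eps ^ i) * embed (fs n i))) \<le> enat (poly q n)"
    unfolding VPe_closure_def VPe_def poly_bounded_def by blast
  have "border_fib_complexity (f n) \<le> enat (poly ((2 * q + 1) ^ 7) n)" for n
    using border_fib_complexity_le_formula_complexity[OF assms q[of n]] by simp
  then show "f \<in> {f \<in> families. poly_bounded (\<lambda>n. border_fib_complexity (f n))}"
    using \<open>f \<in> families\<close> unfolding poly_bounded_def by blast
next
  fix f :: "nat \<Rightarrow> 'a mpoly"
  assume "f \<in> {f \<in> families. poly_bounded (\<lambda>n. border_fib_complexity (f n))}"
  then obtain p q where f: "f \<in> families" and p: "\<And>n. card (mvars (f n)) \<le> poly p n"
    and q: "\<And>n. border_fib_complexity (f n) \<le> enat (poly q n)"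
    unfolding families_def poly_bounded_def by auto
  define G where "G n fs e = embed (f n) + (\<Sum>i = 1..e. mconst (eps ^ i) * embed (fs i))"
    for n e :: nat and fs :: "nat \<Rightarrow> 'a mpoly"
  define B where "B n = (2 * poly q n + 1) ^ 2 * (4 * card (mvars (f n)) + 2)" for n
  have "\<exists>fs e. mvars (G n fs e) \<subseteq> mvars (f n) \<and> formula_complexity (G n fs e) \<le> enat (B n)" for n
    unfolding G_def B_def by (rule formula_complexity_le_border_fib_complexity[OF q])
  then obtain fs e where fs: "\<And>n. mvars (G n (fs n) (e n)) \<subseteq> mvars (f n)"
    "\<And>n. formula_complexity (G n (fs n) (e n)) \<le> enat (B n)"
    by metis
  \<comment> \<open>Membership in \<open>VPe\<close> also requires polynomially many variables in
    the approximating family; this holds because it uses only those of \<open>f n\<close>.\<close>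
  have "card (mvars (G n (fs n) (e n))) \<le> poly p n" for n
    using card_mono[OF finite_mvars fs(1)[of n]] p[of n] by (rule order_trans)
  moreover have "formula_complexity (G n (fs n) (e n)) \<le> enat (poly ((2 * q + 1) ^ 2 * (4 * p + 2)) n)"
    for n
  proof -
    have "B n \<le> (2 * poly q n + 1) ^ 2 * (4 * poly p n + 2)"
      unfolding B_def using p[of n] by (intro mult_mono) auto
    then have "enat (B n) \<le> enat (poly ((2 * q + 1) ^ 2 * (4 * p + 2)) n)" by simp
    with fs(2) show ?thesis by (rule order_trans)
  qed
  ultimately have "(\<lambda>n. G n (fs n) (e n)) \<in> VPe"
    unfolding VPe_def families_def poly_bounded_def mem_Collect_eq enat_ord_simps by blast
  then show "f \<in> VPe_closure"
    unfolding VPe_closure_def mem_Collect_eq G_def using f by (intro conjI exI[of _ fs] exI[of _ e])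
qed

end
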